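(* Let $p\in[1,\infty]$, and assume that proper metric spaces $(X,d_X)$ and $(Y,d_Y)$ admit consistent, conical bicombings $\sigma^X$ and $\sigma^Y$, respectively. Then the boundary $\partial_{\sigma^X\otimes\sigma^Y}(X\times_pY)$ is homeomorphic to the join $\partial_{\sigma^X}X*\partial_{\sigma^Y}Y$ of $\partial_{\sigma^X}X$ and $\partial_{\sigma^Y}Y$.
   Context: Proper means closed balls are compact. A (geodesic) bicombing on a geodesic metric space $(X,d)$ is a continuous map $\sigma\colon X\times X\times[0,1]\to X$ such that each $\sigma_{xy}:=\sigma(x,y,\cdot)$ is a constant speed geodesic from $x$ to $y$. It is consistent if $\operatorname{im}\sigma_{\sigma_{xy}(s),\sigma_{xy}(t)}=\operatorname{im}\sigma_{xy}|_{[s,t]}$ for all $x,y$ and $0\le s<t\le1$; conical if $d(\sigma_{xy}(t),\sigma_{x'y'}(t))\le(1-t)d(x,x')+t\,d(y,y')$ always. $X\times_pY$ is the Cartesian product with metric $d((x_1,y_1),(x_2,y_2))=\|(d_X(x_1,x_2),d_Y(y_1,y_2))\|_p$ ($\ell^p$-norm on $\mathbb R^2$). The product bicombing is $(\sigma^X\otimes\sigma^Y)((x_1,y_1),(x_2,y_2),t)=(\sigma^X_{x_1x_2}(t),\sigma^Y_{y_1y_2}(t))$; it is a consistent, conical bicombing on $X\times_pY$. Boundary of a complete geodesic space $(X,d)$ with consistent, conical $\sigma$: a $\sigma$-ray is an isometric embedding $\xi\colon[0,\infty)\to X$ with $\operatorname{im}\sigma_{\xi(0)\xi(t)}=\operatorname{im}\xi|_{[0,t]}$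 for all $t\ge0$. Two $\sigma$-rays $\xi,\zeta$ are asymptotic if $\sup_{t}d(\xi(t),\zeta(t))<\infty$. $\partial_\sigma X$ is the set of asymptoty classes of $\sigma$-rays; for each $o\in X$, each class $\bar x$ has a unique representative $\varrho_{o,\bar x}$ with $\varrho_{o,\bar x}(0)=o$. The topology on $\partial_\sigma X$ has as base the sets $\{\bar y\in\partial_\sigma X: d(\varrho_{o,\bar y}(t),\varrho_{o,\bar x}(t))<\epsilon\}$, $\bar x\in\partial_\sigma X$, $t\ge0$, $\epsilon>0$, for a fixed $o\in X$ (the topology does not depend on $o$). The join $A*B$ of non-empty $A,B$ is the quotient of $A\times B\times[0,1]$ by $(a,b,0)\sim(a,b',0)$ and $(a,b,1)\sim(a',b,1)$; by convention $A*\emptyset=A$ and $\emptyset*B=B$. *)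

theory Defs
  imports "HOL-Analysis.Analysis"
begin

section \<open>Proper spaces and bicombings\<close>

definition proper_space :: "'a set \<Rightarrow> ('a \<Rightarrow> 'a \<Rightarrow> real) \<Rightarrow> bool" where
  "proper_space M d \<longleftrightarrow>
     (\<forall>x\<in>M. \<forall>r. compactin (Metric_space.mtopology M d) (Metric_space.mcball M d x r))"

definition const_speed_geodesic ::
  "'a set \<Rightarrow> ('a \<Rightarrow> 'a \<Rightarrow> real) \<Rightarrow> (real \<Rightarrow> 'a) \<Rightarrow> 'a \<Rightarrow> 'a \<Rightarrow> bool" where
  "const_speed_geodesic M d \<gamma> x y \<longleftrightarrow>
     \<gamma> \<in> {0..1} \<rightarrow> M \<and> \<gamma> 0 = x \<and> \<gamma> 1 = y \<and>
     (\<forall>s\<in>{0..1}. \<forall>t\<in>{0..1}. d (\<gamma> s) (\<gamma> t) = \<bar>s - t\<bar> * d x y)"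

definition geodesic_space :: "'a set \<Rightarrow> ('a \<Rightarrow> 'a \<Rightarrow> real) \<Rightarrow> bool" where
  "geodesic_space M d \<longleftrightarrow> (\<forall>x\<in>M. \<forall>y\<in>M. \<exists>\<gamma>. const_speed_geodesic M d \<gamma> x y)"

definition bicombing ::
  "'a set \<Rightarrow> ('a \<Rightarrow> 'a \<Rightarrow> real) \<Rightarrow> ('a \<Rightarrow> 'a \<Rightarrow> real \<Rightarrow> 'a) \<Rightarrow> bool" where
  "bicombing M d \<sigma> \<longleftrightarrow>
     geodesic_space M d \<and>
     continuous_map
       (prod_topology (Metric_space.mtopology M d)
         (prod_topology (Metric_space.mtopology M d) (top_of_set {0..1})))
       (Metric_space.mtopology M d)
       (\<lambda>(x, y, t). \<sigma> x y t) \<and>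
     (\<forall>x\<in>M. \<forall>y\<in>M. const_speed_geodesic M d (\<sigma> x y) x y)"

definition consistent :: "'a set \<Rightarrow> ('a \<Rightarrow> 'a \<Rightarrow> real \<Rightarrow> 'a) \<Rightarrow> bool" where
  "consistent M \<sigma> \<longleftrightarrow>
     (\<forall>x\<in>M. \<forall>y\<in>M. \<forall>s t. 0 \<le> s \<and> s < t \<and> t \<le> 1 \<longrightarrow>
        \<sigma> (\<sigma> x y s) (\<sigma> x y t) ` {0..1} = \<sigma> x y ` {s..t})"

definition conical ::
  "'a set \<Rightarrow> ('a \<Rightarrow> 'a \<Rightarrow> real) \<Rightarrow> ('a \<Rightarrow> 'a \<Rightarrow> real \<Rightarrow> 'a) \<Rightarrow> bool" where
  "conical M d \<sigma> \<longleftrightarrow>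
     (\<forall>x\<in>M. \<forall>y\<in>M. \<forall>x'\<in>M. \<forall>y'\<in>M. \<forall>t\<in>{0..1}.
        d (\<sigma> x y t) (\<sigma> x' y' t) \<le> (1 - t) * d x x' + t * d y y')"


section \<open>The \<open>\<ell>\<^sup>p\<close>-product\<close>

definition lp_norm2 :: "ereal \<Rightarrow> real \<Rightarrow> real \<Rightarrow> real" where
  "lp_norm2 p a b =
     (if p = \<infinity> then max \<bar>a\<bar> \<bar>b\<bar>
      else (\<bar>a\<bar> powr real_of_ereal p + \<bar>b\<bar> powr real_of_ereal p) powr (1 / real_of_ereal p))"

definition lp_prod_dist ::
  "ereal \<Rightarrow> ('a \<Rightarrow> 'a \<Rightarrow> real) \<Rightarrow> ('b \<Rightarrow> 'b \<Rightarrow> real) \<Rightarrow> 'a \<times> 'b \<Rightarrow> 'a \<times> 'b \<Rightarrow> real" where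
  "lp_prod_dist p dX dY = (\<lambda>(x1, y1) (x2, y2). lp_norm2 p (dX x1 x2) (dY y1 y2))"

definition prod_bicombing ::
  "('a \<Rightarrow> 'a \<Rightarrow> real \<Rightarrow> 'a) \<Rightarrow> ('b \<Rightarrow> 'b \<Rightarrow> real \<Rightarrow> 'b) \<Rightarrow>
    'a \<times> 'b \<Rightarrow> 'a \<times> 'b \<Rightarrow> real \<Rightarrow> 'a \<times> 'b" where
  "prod_bicombing \<sigma>X \<sigma>Y = (\<lambda>(x1, y1) (x2, y2) t. (\<sigma>X x1 x2 t, \<sigma>Y y1 y2 t))"


section \<open>The boundary\<close>

text \<open>Rays are taken extensional on \<open>[0,\<infinity>)\<close>, so that equality of rays is equality of maps
  defined on \<open>[0,\<infinity>)\<close> only.\<close>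

definition sigma_rays ::
  "'a set \<Rightarrow> ('a \<Rightarrow> 'a \<Rightarrow> real) \<Rightarrow> ('a \<Rightarrow> 'a \<Rightarrow> real \<Rightarrow> 'a) \<Rightarrow> (real \<Rightarrow> 'a) set" where
  "sigma_rays M d \<sigma> =
     {\<xi> \<in> {0..} \<rightarrow>\<^sub>E M.
        (\<forall>s\<ge>0. \<forall>t\<ge>0. d (\<xi> s) (\<xi> t) = \<bar>s - t\<bar>) \<and>
        (\<forall>t\<ge>0. \<sigma> (\<xi> 0) (\<xi> t) ` {0..1} = \<xi> ` {0..t})}"

definition asymptotic ::
  "'a set \<Rightarrow> ('a \<Rightarrow> 'a \<Rightarrow> real) \<Rightarrow> ('a \<Rightarrow> 'a \<Rightarrow> real \<Rightarrow> 'a) \<Rightarrow> (real \<Rightarrow> 'a) rel" where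
  "asymptotic M d \<sigma> =
     {(\<xi>, \<zeta>). \<xi> \<in> sigma_rays M d \<sigma> \<and> \<zeta> \<in> sigma_rays M d \<sigma> \<and>
        bdd_above ((\<lambda>t. d (\<xi> t) (\<zeta> t)) ` {0..})}"

definition boundary ::
  "'a set \<Rightarrow> ('a \<Rightarrow> 'a \<Rightarrow> real) \<Rightarrow> ('a \<Rightarrow> 'a \<Rightarrow> real \<Rightarrow> 'a) \<Rightarrow> (real \<Rightarrow> 'a) set set" where
  "boundary M d \<sigma> = sigma_rays M d \<sigma> // asymptotic M d \<sigma>"

definition ray_from :: "'a \<Rightarrow> (real \<Rightarrow> 'a) set \<Rightarrow> real \<Rightarrow> 'a" where
  "ray_from b c = (THE \<xi>. \<xi> \<in> c \<and> \<xi> 0 = b)"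

definition boundary_base ::
  "'a set \<Rightarrow> ('a \<Rightarrow> 'a \<Rightarrow> real) \<Rightarrow> ('a \<Rightarrow> 'a \<Rightarrow> real \<Rightarrow> 'a) \<Rightarrow> 'a \<Rightarrow>
    (real \<Rightarrow> 'a) set set set" where
  "boundary_base M d \<sigma> b =
     {{c' \<in> boundary M d \<sigma>. d (ray_from b c' t) (ray_from b c t) < \<epsilon>} | c t \<epsilon>.
        c \<in> boundary M d \<sigma> \<and> 0 \<le> t \<and> 0 < \<epsilon>}"

definition boundary_topology ::
  "'a set \<Rightarrow> ('a \<Rightarrow> 'a \<Rightarrow> real) \<Rightarrow> ('a \<Rightarrow> 'a \<Rightarrow> real \<Rightarrow> 'a) \<Rightarrow> 'a \<Rightarrow>
    (real \<Rightarrow> 'a) set topology" where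
  "boundary_topology M d \<sigma> b =
     topology (arbitrary union_of (\<lambda>U. U \<in> boundary_base M d \<sigma> b))"

lemma equiv_asymptotic:
  assumes "Metric_space M d"
  shows "equiv (sigma_rays M d \<sigma>) (asymptotic M d \<sigma>)"
proof (rule equivI)
  interpret Metric_space M d by (rule assms)
  show "asymptotic M d \<sigma> \<subseteq> sigma_rays M d \<sigma> \<times> sigma_rays M d \<sigma>"
    by (auto simp: asymptotic_def)
  show "refl_on (sigma_rays M d \<sigma>) (asymptotic M d \<sigma>)"
    by (auto simp: refl_on_def asymptotic_def sigma_rays_def PiE_iff intro!: bdd_aboveI2[where M=0])
  show "sym (asymptotic M d \<sigma>)"
    by (auto simp: sym_def asymptotic_def commute)
  show "trans (asymptotic M d \<sigma>)"
  proof (rule transI)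
    fix f g h assume fg: "(f, g) \<in> asymptotic M d \<sigma>" and gh: "(g, h) \<in> asymptotic M d \<sigma>"
    then have rays: "f \<in> sigma_rays M d \<sigma>" "g \<in> sigma_rays M d \<sigma>" "h \<in> sigma_rays M d \<sigma>"
      by (auto simp: asymptotic_def)
    obtain A where A: "\<And>t. t \<ge> 0 \<Longrightarrow> d (f t) (g t) \<le> A"
      using fg by (auto simp: asymptotic_def bdd_above_def)
    obtain B where B: "\<And>t. t \<ge> 0 \<Longrightarrow> d (g t) (h t) \<le> B"
      using gh by (auto simp: asymptotic_def bdd_above_def)
    have "d (f t) (h t) \<le> A + B" if t: "t \<ge> 0" for t
    proof -
      have "f t \<in> M" "g t \<in> M" "h t \<in> M"
        using rays t by (auto simp: sigma_rays_def PiE_iff)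
      then have "d (f t) (h t) \<le> d (f t) (g t) + d (g t) (h t)"
        by (rule triangle)
      with A[OF t] B[OF t] show ?thesis by linarith
    qed
    then show "(f, h) \<in> asymptotic M d \<sigma>"
      using rays by (auto simp: asymptotic_def intro!: bdd_aboveI2[where M="A + B"])
  qed
qed


section \<open>The join\<close>

text \<open>The final topology on the image of \<open>X\<close> under \<open>f\<close>. For injective \<open>f\<close> it is a copy of \<open>X\<close>.\<close>

definition image_topology :: "('a \<Rightarrow> 'b) \<Rightarrow> 'a topology \<Rightarrow> 'b topology" where
  "image_topology f X =
     topology (\<lambda>U. U \<subseteq> f ` topspace X \<and> openin X {x \<in> topspace X. f x \<in> U})"

lemma openin_image_topology:
  "openin (image_topology f X) U \<longleftrightarrow>
     U \<subseteq> f ` topspace X \<and> openin X {x \<in> topspace X. f x \<in> U}"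
proof -
  have "istopology (\<lambda>U. U \<subseteq> f ` topspace X \<and> openin X {x \<in> topspace X. f x \<in> U})"
    unfolding istopology_def
  proof (intro conjI allI impI)
    fix S T
    assume "S \<subseteq> f ` topspace X \<and> openin X {x \<in> topspace X. f x \<in> S}"
      "T \<subseteq> f ` topspace X \<and> openin X {x \<in> topspace X. f x \<in> T}"
    moreover have "{x \<in> topspace X. f x \<in> S \<inter> T} =
        {x \<in> topspace X. f x \<in> S} \<inter> {x \<in> topspace X. f x \<in> T}"
      by blast
    ultimately show "S \<inter> T \<subseteq> f ` topspace X" "openin X {x \<in> topspace X. f x \<in> S \<inter> T}"
      by auto
  next
    fix K
    assume K: "\<forall>U\<in>K. U \<subseteq> f ` topspace X \<and> openin X {x \<in> topspace X. f x \<in> U}"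
    then show "\<Union>K \<subseteq> f ` topspace X" by blast
    have "{x \<in> topspace X. f x \<in> \<Union>K} = (\<Union>U\<in>K. {x \<in> topspace X. f x \<in> U})"
      by blast
    then show "openin X {x \<in> topspace X. f x \<in> \<Union>K}"
      using K by auto
  qed
  then show ?thesis
    by (simp add: image_topology_def topology_inverse')
qed

lemma topspace_image_topology: "topspace (image_topology f X) = f ` topspace X"
proof
  show "topspace (image_topology f X) \<subseteq> f ` topspace X"
    by (metis openin_image_topology openin_topspace)
  have "{x \<in> topspace X. f x \<in> f ` topspace X} = topspace X" by blast
  then have "openin (image_topology f X) (f ` topspace X)"
    by (simp add: openin_image_topology)
  then show "f ` topspace X \<subseteq> topspace (image_topology f X)"
    by (rule openin_subset)
qed

lemma quotient_map_image_topology: "quotient_map X (image_topology f X) f"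
  by (auto simp: quotient_map_def openin_image_topology topspace_image_topology)

definition join_rel :: "'a set \<Rightarrow> 'b set \<Rightarrow> ('a \<times> 'b \<times> real) rel" where
  "join_rel A B =
     {((a, b, s), (a', b', t)). a \<in> A \<and> a' \<in> A \<and> b \<in> B \<and> b' \<in> B \<and>
        s \<in> {0..1} \<and> t \<in> {0..1} \<and>
        (a = a' \<and> b = b' \<and> s = t \<or>
         a = a' \<and> s = 0 \<and> t = 0 \<or>
         b = b' \<and> s = 1 \<and> t = 1)}"

lemma equiv_join_rel: "equiv (A \<times> B \<times> {0..1}) (join_rel A B)"
  by (rule equivI) (auto simp: join_rel_def refl_on_def sym_def trans_def)

text \<open>The constructors \<open>End1\<close> and \<open>End2\<close> only serve to give the spaces \<open>A * \<emptyset> = A\<close> and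
  \<open>\<emptyset> * B = B\<close> the same type as the join of non-empty spaces.\<close>

datatype ('a, 'b) join_point = End1 'a | End2 'b | Class "('a \<times> 'b \<times> real) set"

definition join :: "'a topology \<Rightarrow> 'b topology \<Rightarrow> ('a, 'b) join_point topology" where
  "join A B =
     (if topspace B = {} then image_topology End1 A
      else if topspace A = {} then image_topology End2 B
      else image_topology (\<lambda>x. Class (join_rel (topspace A) (topspace B) `` {x}))
             (prod_topology A (prod_topology B (top_of_set {0..1}))))"

end

theory Submission
  imports Defs
begin

text \<open>
  A ray in the product starting at \<open>(x0, y0)\<close> is a pair of rays in the factors run at speeds
  \<open>a, b \<ge> 0\<close> with \<open>\<parallel>(a, b)\<parallel>\<^sub>p = 1\<close>. Parametrising this arc of speeds by \<open>[0, 1]\<close>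
  yields a map from \<open>\<partial>X \<times> \<partial>Y \<times> [0, 1]\<close> onto the boundary of the product
  whose fibres are exactly the classes of the join relation: a component of speed \<open>0\<close> forgets its
  boundary point. The boundary topology is the initial topology of the evaluations
  \<open>c \<mapsto> ray_from b c t\<close>, so this map is continuous, and the boundary of the product is
  Hausdorff. Properness and Tychonoff's theorem make the boundaries of the factors compact, so the
  map is a quotient map and the product boundary is the join. If a factor has no boundary, the
  speed of the corresponding component must be \<open>0\<close>.
\<close>

section \<open>Rays and the boundary of a conical bicombing\<close>

text \<open>That a product ray splits into components of constant speed is not a fact about
  geodesics: for p = 1 a geodesic of the product may have components that change speed, and for p =
  \<infinity> components that are not geodesics at all. The bicombing forces it, because the
  equation \<open>\<sigma> (\<xi> 0) (\<xi> t) s = \<xi> (s * t)\<close> holds in each component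
  separately and already implies constant speed. Since the speeds vary along the arc, a component is
  evaluated at a time that depends on the arc parameter. Continuity at fixed times is therefore not
  enough, and evaluation has to be jointly continuous in class and time. At speed 0 it takes place
  at time 0, where all rays from the base point agree, so the collapsed ends of the join need no
  separate continuity argument. No inverse of the parametrisation is written down: two quotient maps
  out of one space with equal fibres have homeomorphic targets.\<close>

lemma (in Metric_space) MCauchy_if_dist_le_null:
  assumes "range f \<subseteq> M" and "\<And>n m. N \<le> n \<Longrightarrow> n \<le> m \<Longrightarrow> d (f n) (f m) \<le> e n" and "e \<longlonglongrightarrow> 0"
  shows "MCauchy f"
  unfolding MCauchy_def
proof (intro conjI allI impI assms(1))
  fix \<epsilon> :: real assume "\<epsilon> > 0"
  with assms(3) have "\<forall>\<^sub>F n in sequentially. e n < \<epsilon>"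
    by (rule order_tendstoD)
  then obtain K where K: "\<And>n. n \<ge> K \<Longrightarrow> e n < \<epsilon>"
    by (auto simp: eventually_sequentially)
  have "d (f n) (f m) < \<epsilon>" if "max N K \<le> n" "max N K \<le> m" for n m
    using that assms(2)[of n m] assms(2)[of m n] K[of n] K[of m] commute[of "f n" "f m"]
    by (cases "n \<le> m") fastforce+
  then show "\<exists>N. \<forall>n n'. N \<le> n \<longrightarrow> N \<le> n' \<longrightarrow> d (f n) (f n') < \<epsilon>"
    by blast
qed

lemma (in Metric_space) dist_limit:
  assumes "limitin mtopology f x F" "limitin mtopology g y F"
  shows "((\<lambda>n. d (f n) (g n)) \<longlongrightarrow> d x y) F"
proof -
  have lim: "x \<in> M" "\<forall>\<^sub>F n in F. f n \<in> M" "((\<lambda>n. d (f n) x) \<longlongrightarrow> 0) F"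
    "y \<in> M" "\<forall>\<^sub>F n in F. g n \<in> M" "((\<lambda>n. d (g n) y) \<longlongrightarrow> 0) F"
    using assms unfolding limitin_metric_dist_null by auto
  have "((\<lambda>n. d (f n) x + d (g n) y) \<longlongrightarrow> 0) F"
    using tendsto_add[OF lim(3,6)] by simp
  moreover have "\<forall>\<^sub>F n in F. norm (d (f n) (g n) - d x y) \<le> d (f n) x + d (g n) y"
    using lim(2,5)
  proof eventually_elim
    case (elim n)
    then show ?case
      using triangle[of "f n" x "g n"] triangle[of x y "g n"] triangle[of x "f n" y] triangle[of "f n" "g n" y]
        commute[of x "f n"] commute[of y "g n"] lim(1,4) by simp
  qed
  ultimately have "((\<lambda>n. d (f n) (g n) - d x y) \<longlongrightarrow> 0) F"
    by (rule Lim_null_comparison[rotated])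
  then show ?thesis
    by (rule LIM_zero_cancel)
qed

text \<open>Consistency only enters through initial segments, which, unlike images, can be compared
  parameter by parameter.\<close>

locale conical_bicombing = Metric_space M d for M :: "'a set" and d +
  fixes \<sigma> :: "'a \<Rightarrow> 'a \<Rightarrow> real \<Rightarrow> 'a"
  assumes complete: mcomplete
    and geodesic: "\<lbrakk>x \<in> M; y \<in> M\<rbrakk> \<Longrightarrow> const_speed_geodesic M d (\<sigma> x y) x y"
    and initial_segment: "\<lbrakk>x \<in> M; y \<in> M; s \<in> {0..1}; t \<in> {0..1}\<rbrakk> \<Longrightarrow> \<sigma> x (\<sigma> x y t) s = \<sigma> x y (s * t)"
    and conical: "conical M d \<sigma>"
begin

lemma geodesic_simps:
  assumes "x \<in> M" "y \<in> M"
  shows geodesic_0: "\<sigma> x y 0 = x" and geodesic_1: "\<sigma> x y 1 = y"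
    and geodesic_in: "t \<in> {0..1} \<Longrightarrow> \<sigma> x y t \<in> M"
    and geodesic_dist: "s \<in> {0..1} \<Longrightarrow> t \<in> {0..1} \<Longrightarrow> d (\<sigma> x y s) (\<sigma> x y t) = \<bar>s - t\<bar> * d x y"
  using geodesic[OF assms] by (auto simp: const_speed_geodesic_def)

lemma geodesic_dist_start:
  assumes "x \<in> M" "y \<in> M" "t \<in> {0..1}"
  shows "d x (\<sigma> x y t) = t * d x y"
  using geodesic_dist[OF assms(1,2), of 0 t] geodesic_0[OF assms(1,2)] assms(3) by simp

lemma conicalD:
  assumes "x \<in> M" "y \<in> M" "x' \<in> M" "y' \<in> M" "t \<in> {0..1}"
  shows "d (\<sigma> x y t) (\<sigma> x' y' t) \<le> (1 - t) * d x x' + t * d y y'"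
  using conical assms unfolding conical_def by blast

text \<open>On both sides points are told apart by their distance from \<open>\<xi> 0\<close>, so
  equality of images forces equality of parameters. The pointwise equation is the form that passes
  to limits and to the components of a product.\<close>

lemma sigma_rays_iff:
  "\<xi> \<in> sigma_rays M d \<sigma> \<longleftrightarrow>
     \<xi> \<in> {0..} \<rightarrow>\<^sub>E M \<and> (\<forall>s\<ge>0. \<forall>t\<ge>0. d (\<xi> s) (\<xi> t) = \<bar>s - t\<bar>) \<and>
     (\<forall>t\<ge>0. \<forall>s\<in>{0..1}. \<sigma> (\<xi> 0) (\<xi> t) s = \<xi> (s * t))"
proof -
  have "\<sigma> (\<xi> 0) (\<xi> t) ` {0..1} = \<xi> ` {0..t} \<longleftrightarrow> (\<forall>s\<in>{0..1}. \<sigma> (\<xi> 0) (\<xi> t) s = \<xi> (s * t))"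
    if \<xi>: "\<xi> \<in> {0..} \<rightarrow>\<^sub>E M" and iso: "\<And>s t. s \<ge> 0 \<Longrightarrow> t \<ge> 0 \<Longrightarrow> d (\<xi> s) (\<xi> t) = \<bar>s - t\<bar>" and "t \<ge> 0" for t
  proof
    have M: "\<xi> 0 \<in> M" "\<xi> t \<in> M"
      using \<xi> \<open>t \<ge> 0\<close> by (auto simp: PiE_iff)
    assume img: "\<sigma> (\<xi> 0) (\<xi> t) ` {0..1} = \<xi> ` {0..t}"
    show "\<forall>s\<in>{0..1}. \<sigma> (\<xi> 0) (\<xi> t) s = \<xi> (s * t)"
    proof
      fix s :: real assume s: "s \<in> {0..1}"
      then have "\<sigma> (\<xi> 0) (\<xi> t) s \<in> \<xi> ` {0..t}"
        unfolding img[symmetric] by (rule imageI)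
      then obtain u where u: "u \<in> {0..t}" "\<sigma> (\<xi> 0) (\<xi> t) s = \<xi> u"
        by blast
      have "u = s * t"
        using geodesic_dist_start[OF M s] iso[of 0 u] iso[of 0 t] u \<open>t \<ge> 0\<close> by simp
      with u show "\<sigma> (\<xi> 0) (\<xi> t) s = \<xi> (s * t)" by simp
    qed
  next
    assume eq: "\<forall>s\<in>{0..1}. \<sigma> (\<xi> 0) (\<xi> t) s = \<xi> (s * t)"
    have "{0..t} = (\<lambda>s. s * t) ` {0..1}"
      using image_mult_atLeastAtMost_if'[of t 0 1] \<open>t \<ge> 0\<close>
      by (auto simp: mult.commute split: if_splits)
    then show "\<sigma> (\<xi> 0) (\<xi> t) ` {0..1} = \<xi> ` {0..t}"
      using eq by (simp add: image_image)
  qed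
  then show ?thesis
    unfolding sigma_rays_def mem_Collect_eq
    by (intro conj_cong refl all_cong imp_cong) auto
qed

lemma
  assumes "\<xi> \<in> sigma_rays M d \<sigma>"
  shows ray_in: "t \<ge> 0 \<Longrightarrow> \<xi> t \<in> M"
    and ray_dist: "s \<ge> 0 \<Longrightarrow> t \<ge> 0 \<Longrightarrow> d (\<xi> s) (\<xi> t) = \<bar>s - t\<bar>"
    and ray_segment: "t \<ge> 0 \<Longrightarrow> s \<in> {0..1} \<Longrightarrow> \<sigma> (\<xi> 0) (\<xi> t) s = \<xi> (s * t)"
    and ray_extensional: "\<xi> \<in> extensional {0..}"
  using assms unfolding sigma_rays_iff by (auto simp: PiE_iff)

lemma ray_segment':
  assumes "\<xi> \<in> sigma_rays M d \<sigma>" "0 \<le> s" "s \<le> t" "0 < t"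
  shows "\<xi> s = \<sigma> (\<xi> 0) (\<xi> t) (s / t)"
  using ray_segment[OF assms(1), of t "s / t"] assms by simp

lemma rays_conical:
  assumes \<xi>: "\<xi> \<in> sigma_rays M d \<sigma>" and \<zeta>: "\<zeta> \<in> sigma_rays M d \<sigma>" and st: "0 \<le> s" "s \<le> t" "0 < t"
  shows "d (\<xi> s) (\<zeta> s) \<le> (1 - s / t) * d (\<xi> 0) (\<zeta> 0) + s / t * d (\<xi> t) (\<zeta> t)"
  unfolding ray_segment'[OF \<xi> st] ray_segment'[OF \<zeta> st]
  using st by (intro conicalD) (auto intro!: ray_in \<xi> \<zeta>)

text \<open>It serves twice: with \<open>y\<close> on \<open>\<xi>\<close> itself in the
  construction of an asymptotic ray, where only the first term survives, and with
  \<open>b = \<xi> 0\<close> in the change of base point, where only the second does.\<close>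

lemma ray_to_point_conical:
  assumes \<xi>: "\<xi> \<in> sigma_rays M d \<sigma>" and b: "b \<in> M" "y \<in> M" and st: "0 \<le> s" "s \<le> t" "0 < t"
  shows "d (\<sigma> b y (s / t)) (\<xi> s) \<le> (1 - s / t) * d b (\<xi> 0) + s / t * d y (\<xi> t)"
  unfolding ray_segment'[OF \<xi> st]
  using st b by (intro conicalD) (auto intro!: ray_in \<xi>)

text \<open>Let \<open>t\<close> tend to infinity in \<open>rays_conical\<close>: the weight
  \<open>s / t\<close> kills the bounded distance at time \<open>t\<close>. Uniqueness of the
  representative from a given point is the case of equal starts.\<close>

lemma asymptotic_dist_le:
  assumes asym: "(\<xi>, \<zeta>) \<in> asymptotic M d \<sigma>" and "s \<ge> 0"
  shows "d (\<xi> s) (\<zeta> s) \<le> d (\<xi> 0) (\<zeta> 0)"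
proof -
  have rays: "\<xi> \<in> sigma_rays M d \<sigma>" "\<zeta> \<in> sigma_rays M d \<sigma>"
    using asym by (auto simp: asymptotic_def)
  obtain B where B: "\<And>t. t \<ge> 0 \<Longrightarrow> d (\<xi> t) (\<zeta> t) \<le> B"
    using asym by (auto simp: asymptotic_def bdd_above_def)
  have "((\<lambda>t. (1 - s / t) * d (\<xi> 0) (\<zeta> 0) + s / t * B) \<longlongrightarrow> (1 - 0) * d (\<xi> 0) (\<zeta> 0) + 0 * B) at_top"
    by (intro tendsto_intros real_tendsto_divide_at_top[OF tendsto_const filterlim_ident])
  moreover have "\<forall>\<^sub>F t in at_top. d (\<xi> s) (\<zeta> s) \<le> (1 - s / t) * d (\<xi> 0) (\<zeta> 0) + s / t * B"
    using eventually_gt_at_top[of "max s 0"]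
  proof eventually_elim
    case (elim t)
    then have "s / t * d (\<xi> t) (\<zeta> t) \<le> s / t * B"
      using B[of t] \<open>s \<ge> 0\<close> by (intro mult_left_mono) auto
    with rays_conical[OF rays, of s t] elim \<open>s \<ge> 0\<close> show ?case by simp
  qed
  ultimately have "d (\<xi> s) (\<zeta> s) \<le> (1 - 0) * d (\<xi> 0) (\<zeta> 0) + 0 * B"
    by (rule tendsto_lowerbound) simp
  then show ?thesis by simp
qed

lemma asymptotic_eqI:
  assumes asym: "(\<xi>, \<zeta>) \<in> asymptotic M d \<sigma>" and "\<xi> 0 = \<zeta> 0"
  shows "\<xi> = \<zeta>"
proof
  fix t
  have rays: "\<xi> \<in> sigma_rays M d \<sigma>" "\<zeta> \<in> sigma_rays M d \<sigma>"
    using asym by (auto simp: asymptotic_def)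
  show "\<xi> t = \<zeta> t"
  proof (cases "t \<ge> 0")
    case True
    then have "d (\<xi> t) (\<zeta> t) \<le> 0"
      using asymptotic_dist_le[OF asym True] assms(2) ray_in[OF rays(2), of 0] by simp
    then show ?thesis
      using ray_in[OF rays(1) True] ray_in[OF rays(2) True] nonneg[of "\<xi> t" "\<zeta> t"] zero by simp
  next
    case False
    then show ?thesis
      using ray_extensional[OF rays(1)] ray_extensional[OF rays(2)] by (simp add: extensional_def)
  qed
qed

text \<open>The ray is the limit of the geodesics from \<open>b\<close> to \<open>\<xi> n\<close>.
  Two of them differ at time \<open>s\<close> by at most \<open>s / n * D\<close>, so they form a
  Cauchy sequence at each time.\<close>

lemma exists_asymptotic_ray_from:
  assumes \<xi>: "\<xi> \<in> sigma_rays M d \<sigma>" and b: "b \<in> M"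
  obtains \<eta> where "(\<xi>, \<eta>) \<in> asymptotic M d \<sigma>" "\<eta> 0 = b"
proof -
  define D where "D = d b (\<xi> 0)"
  \<comment> \<open>Time is scaled so that \<open>\<xi> n\<close> is reached at time
    \<open>n\<close>, which makes the speed only approximately 1. The default \<open>b\<close> keeps
    all values in \<open>M\<close>; for fixed \<open>s\<close> it is used by finitely many
    \<open>n\<close> only.\<close>
  define h where "h n s = (if s \<le> real n \<and> 0 < n then \<sigma> b (\<xi> (real n)) (s / real n) else b)" for n s
  note [simp] = ray_in[OF \<xi>] b
  have h_in: "h n s \<in> M" if "s \<ge> 0" for n s
    using that by (auto simp: h_def intro!: geodesic_in)
  have h_\<xi>: "d (h n s) (\<xi> s) \<le> D" if "0 \<le> s" "s \<le> n" "0 < n" for n and s :: real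
  proof -
    have "d (h n s) (\<xi> s) \<le> (1 - s / n) * D"
      using ray_to_point_conical[OF \<xi> b, of "\<xi> n" s n] that by (simp add: h_def D_def)
    also have "\<dots> \<le> 1 * D"
      using that by (intro mult_right_mono) (auto simp: D_def)
    finally show ?thesis by simp
  qed
  \<comment> \<open>Cutting the geodesic to \<open>\<xi> m\<close> at time \<open>t\<close> leaves
    the geodesic from \<open>b\<close> to \<open>h m t\<close>.\<close>
  have h_h: "h m s = \<sigma> b (h m t) (s / t)" if "0 \<le> s" "s \<le> t" "0 < t" "t \<le> m" for m s t
    using that initial_segment[OF b, of "\<xi> m" "s / t" "t / m"] by (simp add: h_def)
  have h_diff: "d (h n s) (h m s) \<le> s / n * D" if "0 \<le> s" "s \<le> n" "0 < n" "n \<le> m" for n m s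
  proof -
    \<comment> \<open>Both curves become geodesics from \<open>b\<close>, ending at time
      \<open>n\<close> in \<open>\<xi> n\<close> and \<open>h m n\<close>, which are at most
      \<open>D\<close> apart.\<close>
    have "d (h n s) (h m s) = d (\<sigma> b (\<xi> n) (s / n)) (\<sigma> b (h m n) (s / n))"
      using that h_h[of s n m] by (simp add: h_def)
    also have "\<dots> \<le> (1 - s / n) * d b b + s / n * d (\<xi> n) (h m n)"
      using that by (intro conicalD h_in) auto
    also have "\<dots> \<le> s / n * D"
      using h_\<xi>[of n m] that by (auto simp: commute intro!: divide_right_mono mult_left_mono)
    finally show ?thesis .
  qed
  have "\<exists>l. limitin mtopology (\<lambda>n. h n s) l sequentially" if "s \<ge> 0" for s
  proof -
    have "MCauchy (\<lambda>n. h n s)"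
    proof (rule MCauchy_if_dist_le_null)
      show "range (\<lambda>n. h n s) \<subseteq> M" using h_in[OF that] by auto
      \<comment> \<open>The successor makes \<open>n\<close> positive as well as at least
        \<open>s\<close>.\<close>
      show "d (h n s) (h m s) \<le> s * D / real n" if "Suc (nat \<lceil>s\<rceil>) \<le> n" "n \<le> m" for n m
      proof -
        have "s \<le> real n" using that by linarith
        then show ?thesis
          using h_diff[of s n m] that \<open>s \<ge> 0\<close> by (simp add: algebra_simps)
      qed
      show "(\<lambda>n. s * D / real n) \<longlonglongrightarrow> 0" by (rule lim_const_over_n)
    qed
    then show ?thesis using complete by (auto simp: mcomplete_def)
  qed
  then obtain \<eta>0 where lim0: "\<And>s. s \<ge> 0 \<Longrightarrow> limitin mtopology (\<lambda>n. h n s) (\<eta>0 s) sequentially"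
    by metis
  define \<eta> where "\<eta> = restrict \<eta>0 {0..}"
  have lim: "limitin mtopology (\<lambda>n. h n s) (\<eta> s) sequentially" if "s \<ge> 0" for s
    using lim0[OF that] that by (simp add: \<eta>_def)
  have \<eta>_in: "\<eta> s \<in> M" if "s \<ge> 0" for s
    using lim[OF that] limitin_mspace by blast
  have ev: "\<forall>\<^sub>F n in sequentially. t \<le> real n \<and> 0 < n" for t
    using eventually_ge_at_top[of "Suc (nat \<lceil>t\<rceil>)"] by eventually_elim linarith
  have "limitin mtopology (\<lambda>n. b) b sequentially"
    by (simp add: limitin_metric)
  moreover have h0: "h n 0 = b" for n
    using geodesic_0 by (auto simp: h_def)
  ultimately have \<eta>0: "\<eta> 0 = b"
    using lim[of 0] limitin_metric_unique[of "\<lambda>n. b" "\<eta> 0" sequentially b] by simp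
  have near: "d (\<eta> s) (\<xi> s) \<le> D" if "s \<ge> 0" for s
  proof (rule tendsto_upperbound)
    show "(\<lambda>n. d (h n s) (\<xi> s)) \<longlonglongrightarrow> d (\<eta> s) (\<xi> s)"
      using that by (intro dist_limit lim) (auto simp: limitin_metric)
    show "\<forall>\<^sub>F n in sequentially. d (h n s) (\<xi> s) \<le> D"
      using ev[of s] by eventually_elim (use that h_\<xi> in auto)
  qed simp
  have iso: "d (\<eta> s) (\<eta> t) = \<bar>s - t\<bar>" if "s \<ge> 0" "t \<ge> 0" for s t
  proof (rule LIMSEQ_unique)
    show "(\<lambda>n. d (h n s) (h n t)) \<longlonglongrightarrow> d (\<eta> s) (\<eta> t)"
      using that by (intro dist_limit lim)
    \<comment> \<open>The speed of \<open>h n\<close> is \<open>d b (\<xi> n) / n\<close>, which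
      lies between \<open>1 - D / n\<close> and \<open>1 + D / n\<close> by the triangle
      inequality.\<close>
    have "(\<lambda>n. \<bar>s - t\<bar> * (d b (\<xi> (real n)) / real n)) \<longlonglongrightarrow> \<bar>s - t\<bar> * 1"
    proof (rule tendsto_mult_left, rule tendsto_sandwich)
      have dn: "real n - D \<le> d b (\<xi> (real n))" "d b (\<xi> (real n)) \<le> real n + D" for n
        using ray_dist[OF \<xi>, of 0 "real n"] triangle[of b "\<xi> 0" "\<xi> (real n)"]
          triangle[of "\<xi> 0" b "\<xi> (real n)"] commute[of b "\<xi> 0"] by (auto simp: D_def)
      show "\<forall>\<^sub>F n in sequentially. 1 - D / real n \<le> d b (\<xi> (real n)) / real n"
        using ev[of 0]
      proof eventually_elim
        case (elim n)
        then show ?case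
          using divide_right_mono[OF dn(1), of n n] by (simp add: diff_divide_distrib)
      qed
      show "\<forall>\<^sub>F n in sequentially. d b (\<xi> (real n)) / real n \<le> 1 + D / real n"
        using ev[of 0]
      proof eventually_elim
        case (elim n)
        then show ?case
          using divide_right_mono[OF dn(2), of n n] by (simp add: add_divide_distrib)
      qed
      show "(\<lambda>n. 1 - D / real n) \<longlonglongrightarrow> 1"
        using tendsto_diff[OF tendsto_const lim_const_over_n] by fastforce
      show "(\<lambda>n. 1 + D / real n) \<longlonglongrightarrow> 1"
        using tendsto_add[OF tendsto_const lim_const_over_n] by fastforce
    qed
    moreover have "\<forall>\<^sub>F n in sequentially. \<bar>s - t\<bar> * (d b (\<xi> (real n)) / real n) = d (h n s) (h n t)"
      using ev[of s] ev[of t]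
    proof eventually_elim
      case (elim n)
      have "\<bar>s / n - t / n\<bar> = \<bar>s - t\<bar> / n"
        by (simp add: diff_divide_distrib[symmetric])
      with elim that show ?case
        by (simp add: h_def geodesic_dist)
    qed
    ultimately have "(\<lambda>n. d (h n s) (h n t)) \<longlonglongrightarrow> \<bar>s - t\<bar> * 1"
      by (rule Lim_transform_eventually)
    then show "(\<lambda>n. d (h n s) (h n t)) \<longlonglongrightarrow> \<bar>s - t\<bar>"
      by simp
  qed
  have seg: "\<sigma> (\<eta> 0) (\<eta> t) s = \<eta> (s * t)" if "t \<ge> 0" "s \<in> {0..1}" for s t
  proof (rule limitin_metric_unique)
    have st: "0 \<le> s * t" "s * t \<le> t"
      using that by (auto simp: mult_left_le_one_le)
    show "limitin mtopology (\<lambda>n. h n (s * t)) (\<eta> (s * t)) sequentially"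
      using lim st by blast
    \<comment> \<open>For large \<open>n\<close> the point \<open>h n (s * t)\<close> is
      \<open>\<sigma> b (h n t) s\<close>, and by conicality this follows its endpoint
      \<open>h n t\<close> to the limit \<open>\<eta> t\<close>.\<close>
    show "limitin mtopology (\<lambda>n. h n (s * t)) (\<sigma> (\<eta> 0) (\<eta> t) s) sequentially"
      unfolding limitin_metric_dist_null
    proof (intro conjI)
      show "\<sigma> (\<eta> 0) (\<eta> t) s \<in> M"
        using that by (intro geodesic_in) (auto simp: \<eta>_in)
      show "\<forall>\<^sub>F n in sequentially. h n (s * t) \<in> M"
        using h_in st by simp
      have "(\<lambda>n. s * d (h n t) (\<eta> t)) \<longlonglongrightarrow> s * 0"
        using lim[of t] that unfolding limitin_metric_dist_null by (intro tendsto_intros) auto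
      then have l: "(\<lambda>n. s * d (h n t) (\<eta> t)) \<longlonglongrightarrow> 0" by simp
      show "(\<lambda>n. d (h n (s * t)) (\<sigma> (\<eta> 0) (\<eta> t) s)) \<longlonglongrightarrow> 0"
      proof (rule Lim_null_comparison[OF _ l])
        show "\<forall>\<^sub>F n in sequentially. norm (d (h n (s * t)) (\<sigma> (\<eta> 0) (\<eta> t) s)) \<le> s * d (h n t) (\<eta> t)"
          using ev[of t]
        proof eventually_elim
          case (elim n)
          have "h n (s * t) = \<sigma> b (h n t) s"
          \<comment> \<open>\<open>h_h\<close> divides by \<open>t\<close>; at \<open>t = 0\<close>
            both sides are \<open>b\<close>.\<close>
          proof (cases "t = 0")
            case True
            have "d b (\<sigma> b b s) = 0"
              using geodesic_dist_start[OF b b] that by simp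
            then show ?thesis
              using True h0 zero[OF b geodesic_in[OF b b, of s]] that by simp
          next
            case False
            then show ?thesis
              using h_h[of "s * t" t n] st that(1) elim by simp
          qed
          then show ?case
            using conicalD[OF b h_in[of t n] b \<eta>_in[of t], of s] that by (simp add: \<eta>0)
        qed
      qed
    qed
  qed simp
  have ray: "\<eta> \<in> sigma_rays M d \<sigma>"
    unfolding sigma_rays_iff using \<eta>_in iso seg by (auto simp: \<eta>_def)
  then have "(\<xi>, \<eta>) \<in> asymptotic M d \<sigma>"
    using \<xi> near by (auto simp: asymptotic_def commute intro!: bdd_aboveI2[where M = D])
  then show thesis
    using \<eta>0 that by blast
qed

section \<open>Boundary classes and their representatives\<close>

lemma equiv_asym: "equiv (sigma_rays M d \<sigma>) (asymptotic M d \<sigma>)"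
  by (rule equiv_asymptotic) (rule Metric_space_axioms)

text \<open>Asymptotic rays exist from every point, and two of them with the same start coincide.
  This gives meaning to the definite description in \<open>ray_from\<close>.\<close>

lemma boundary_class_unique:
  assumes c: "c \<in> boundary M d \<sigma>" and b: "b \<in> M"
  shows "\<exists>!\<xi>. \<xi> \<in> c \<and> \<xi> 0 = b"
proof -
  obtain \<xi> where \<xi>: "\<xi> \<in> sigma_rays M d \<sigma>" "c = asymptotic M d \<sigma> `` {\<xi>}"
    using c by (auto simp: boundary_def elim: quotientE)
  obtain \<eta> where \<eta>: "(\<xi>, \<eta>) \<in> asymptotic M d \<sigma>" "\<eta> 0 = b"
    using exists_asymptotic_ray_from[OF \<xi>(1) b] .
  moreover have "\<zeta> = \<eta>" if "\<zeta> \<in> c" "\<zeta> 0 = b" for \<zeta>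
    using that \<xi>(2) \<eta> asymptotic_eqI[of \<zeta> \<eta>] equiv_asym
    by (metis Image_singleton_iff equivE symE transE)
  ultimately show ?thesis using \<xi>(2) by blast
qed

lemma
  assumes "c \<in> boundary M d \<sigma>" "b \<in> M"
  shows ray_from_in_class: "ray_from b c \<in> c" and ray_from_0: "ray_from b c 0 = b"
  using theI'[OF boundary_class_unique[OF assms]] by (auto simp: ray_from_def)

lemma
  assumes "c \<in> boundary M d \<sigma>" "b \<in> M"
  shows ray_from_ray: "ray_from b c \<in> sigma_rays M d \<sigma>"
    and class_ray_from: "asymptotic M d \<sigma> `` {ray_from b c} = c"
proof -
  show "ray_from b c \<in> sigma_rays M d \<sigma>"
    using assms ray_from_in_class in_quotient_imp_subset[OF equiv_asym] by (auto simp: boundary_def)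
  show "asymptotic M d \<sigma> `` {ray_from b c} = c"
    using assms ray_from_in_class[OF assms] equiv_asym
    by (metis Image_singleton_iff boundary_def equiv_class_eq quotientE)
qed

lemma ray_from_in: "\<lbrakk>c \<in> boundary M d \<sigma>; b \<in> M; t \<ge> 0\<rbrakk> \<Longrightarrow> ray_from b c t \<in> M"
  by (rule ray_in[OF ray_from_ray])

lemma class_in_boundary: "\<xi> \<in> sigma_rays M d \<sigma> \<Longrightarrow> asymptotic M d \<sigma> `` {\<xi>} \<in> boundary M d \<sigma>"
  by (simp add: boundary_def quotientI)

lemma ray_from_class:
  assumes "\<xi> \<in> sigma_rays M d \<sigma>"
  shows "ray_from (\<xi> 0) (asymptotic M d \<sigma> `` {\<xi>}) = \<xi>"
proof -
  have "\<xi> \<in> asymptotic M d \<sigma> `` {\<xi>}"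
    using equiv_class_self[OF equiv_asym assms] .
  then show ?thesis
    using boundary_class_unique[OF class_in_boundary[OF assms] ray_in[OF assms order_refl]]
    unfolding ray_from_def by (intro the1_equality) auto
qed

lemma ray_from_asymptotic:
  assumes "c \<in> boundary M d \<sigma>" "b \<in> M" "b' \<in> M"
  shows "(ray_from b c, ray_from b' c) \<in> asymptotic M d \<sigma>"
  using assms ray_from_in_class class_ray_from by blast

end

section \<open>The topology of the boundary\<close>

context conical_bicombing
begin

text \<open>A common start removes the first term of the conical inequality, so distances grow with
  time. Closeness at a late time thus controls all earlier times.\<close>

lemma ray_from_dist_mono:
  assumes "c \<in> boundary M d \<sigma>" "c' \<in> boundary M d \<sigma>" "b \<in> M" and st: "0 \<le> s" "s \<le> t"
  shows "d (ray_from b c s) (ray_from b c' s) \<le> d (ray_from b c t) (ray_from b c' t)"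
proof (cases "t = 0")
  case False
  have "d (ray_from b c s) (ray_from b c' s) \<le> (1 - s / t) * d b b + s / t * d (ray_from b c t) (ray_from b c' t)"
    using rays_conical[of "ray_from b c" "ray_from b c'" s t] assms False
    by (simp add: ray_from_ray ray_from_0)
  also have "\<dots> \<le> 1 * d (ray_from b c t) (ray_from b c' t)"
    using assms False mult_right_mono[of "s / t" 1 "d (ray_from b c t) (ray_from b c' t)"] by simp
  finally show ?thesis by simp
qed (use st in auto)

text \<open>\<open>boundary_topology\<close> is built with \<open>topology\<close>, so its open sets
  are the intended ones only once the balls are known to form a base.\<close>

lemma openin_boundary_topology:
  assumes b: "b \<in> M"
  shows "openin (boundary_topology M d \<sigma> b) = arbitrary union_of (\<lambda>U. U \<in> boundary_base M d \<sigma> b)"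
proof -
  let ?B = "\<lambda>c t \<epsilon>. {c' \<in> boundary M d \<sigma>. d (ray_from b c' t) (ray_from b c t) < \<epsilon>}"
  have "istopology (arbitrary union_of (\<lambda>U. U \<in> boundary_base M d \<sigma> b))"
    unfolding istopology_base_eq arbitrary_union_of_alt
  proof (intro allI impI ballI, elim conjE)
    fix S T c assume "S \<in> boundary_base M d \<sigma> b" "T \<in> boundary_base M d \<sigma> b" and c: "c \<in> S \<inter> T"
    then obtain c1 t1 e1 c2 t2 e2 where
      S: "S = ?B c1 t1 e1" "c1 \<in> boundary M d \<sigma>" "t1 \<ge> 0" and
      T: "T = ?B c2 t2 e2" "c2 \<in> boundary M d \<sigma>" "t2 \<ge> 0"
      unfolding boundary_base_def by blast
    have cb: "c \<in> boundary M d \<sigma>" using c S by simp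
    \<comment> \<open>The smaller of the two slacks left at \<open>c\<close>. Closeness within it at
      the later time carries back to \<open>t1\<close> and \<open>t2\<close> by
      monotonicity.\<close>
    define e where "e = min (e1 - d (ray_from b c t1) (ray_from b c1 t1)) (e2 - d (ray_from b c t2) (ray_from b c2 t2))"
    have "e > 0" using c S T by (auto simp: e_def)
    define U where "U = ?B c (max t1 t2) e"
    have "U \<in> boundary_base M d \<sigma> b"
      unfolding U_def boundary_base_def using cb S \<open>e > 0\<close> by fastforce
    moreover have "c \<in> U"
      using cb \<open>e > 0\<close> S ray_in[OF ray_from_ray[OF cb b], of "max t1 t2"] by (simp add: U_def)
    moreover have "U \<subseteq> S \<inter> T"
    proof
      fix c' assume "c' \<in> U"
      then have c': "c' \<in> boundary M d \<sigma>" "d (ray_from b c' (max t1 t2)) (ray_from b c (max t1 t2)) < e"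
        by (auto simp: U_def)
      have tri: "d (ray_from b c' t) (ray_from b c3 t) < e + d (ray_from b c t) (ray_from b c3 t)"
        if "0 \<le> t" "t \<le> max t1 t2" "c3 \<in> boundary M d \<sigma>" for t c3
        using ray_from_dist_mono[OF c'(1) cb b that(1,2)] c'(2) that
          triangle[of "ray_from b c' t" "ray_from b c t" "ray_from b c3 t"] c' cb b ray_from_in by simp
      show "c' \<in> S \<inter> T"
        using tri[of t1 c1] tri[of t2 c2] S T c'(1) by (auto simp: e_def)
    qed
    ultimately show "\<exists>U. U \<in> boundary_base M d \<sigma> b \<and> c \<in> U \<and> U \<subseteq> S \<inter> T"
      by blast
  qed
  then show ?thesis
    by (simp add: boundary_topology_def topology_inverse')
qed

lemma openin_boundary_ball:
  assumes "b \<in> M" "c \<in> boundary M d \<sigma>" "t \<ge> 0" "e > 0"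
  shows "openin (boundary_topology M d \<sigma> b) {c' \<in> boundary M d \<sigma>. d (ray_from b c' t) (ray_from b c t) < e}"
  unfolding openin_boundary_topology[OF assms(1)]
  by (intro union_of_inc) (use assms in \<open>auto simp: boundary_base_def arbitrary_def\<close>)

lemma topspace_boundary_topology:
  assumes b: "b \<in> M"
  shows "topspace (boundary_topology M d \<sigma> b) = boundary M d \<sigma>"
proof
  show "topspace (boundary_topology M d \<sigma> b) \<subseteq> boundary M d \<sigma>"
    using openin_topspace[of "boundary_topology M d \<sigma> b"]
    unfolding openin_boundary_topology[OF b] arbitrary_union_of_alt by (force simp: boundary_base_def)
  show "boundary M d \<sigma> \<subseteq> topspace (boundary_topology M d \<sigma> b)"
  proof
    fix c assume c: "c \<in> boundary M d \<sigma>"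
    then have "c \<in> {c' \<in> boundary M d \<sigma>. d (ray_from b c' 0) (ray_from b c 0) < 1}"
      using b by (simp add: ray_from_0)
    then show "c \<in> topspace (boundary_topology M d \<sigma> b)"
      using openin_subset[OF openin_boundary_ball[OF b c, of 0 1]] by auto
  qed
qed

text \<open>A basic set is the preimage of a metric ball under a single evaluation. Conversely, an
  evaluation is continuous at \<open>c\<close> because the basic set of radius \<open>e\<close>
  around \<open>c\<close> maps into the ball of radius \<open>e\<close>.\<close>

lemma continuous_map_boundary_iff:
  assumes b: "b \<in> M"
  shows "continuous_map Z (boundary_topology M d \<sigma> b) f \<longleftrightarrow>
    f \<in> topspace Z \<rightarrow> boundary M d \<sigma> \<and> (\<forall>t\<ge>0. continuous_map Z mtopology (\<lambda>z. ray_from b (f z) t))"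
proof safe
  assume f: "continuous_map Z (boundary_topology M d \<sigma> b) f"
  show "f z \<in> boundary M d \<sigma>" if "z \<in> topspace Z" for z
    using f that by (auto simp: continuous_map_def topspace_boundary_topology[OF b])
  fix t :: real assume t: "t \<ge> 0"
  have "continuous_map (boundary_topology M d \<sigma> b) mtopology (\<lambda>c. ray_from b c t)"
    unfolding continuous_map_to_metric topspace_boundary_topology[OF b]
  proof (intro ballI allI impI)
    fix c and e :: real assume "c \<in> boundary M d \<sigma>" "e > 0"
    then show "\<exists>U. openin (boundary_topology M d \<sigma> b) U \<and> c \<in> U \<and> (\<forall>y\<in>U. ray_from b y t \<in> mball (ray_from b c t) e)"
      using openin_boundary_ball[OF b, of c t e] t b
      by (intro exI[of _ "{c' \<in> boundary M d \<sigma>. d (ray_from b c' t) (ray_from b c t) < e}"])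
        (auto simp: commute ray_from_in)
  qed
  from continuous_map_compose[OF f this]
  show "continuous_map Z mtopology (\<lambda>z. ray_from b (f z) t)" by (simp add: o_def)
next
  assume f: "f \<in> topspace Z \<rightarrow> boundary M d \<sigma>"
    and ev: "\<forall>t\<ge>0. continuous_map Z mtopology (\<lambda>z. ray_from b (f z) t)"
  show "continuous_map Z (boundary_topology M d \<sigma> b) f"
  proof (rule continuous_map_into_topology_base[OF openin_boundary_topology[OF b]])
    show "f z \<in> topspace (boundary_topology M d \<sigma> b)" if "z \<in> topspace Z" for z
      using f that by (auto simp: topspace_boundary_topology[OF b])
    fix U assume "U \<in> boundary_base M d \<sigma> b"
    then obtain c t e where U: "U = {c' \<in> boundary M d \<sigma>. d (ray_from b c' t) (ray_from b c t) < e}"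
      and ct: "c \<in> boundary M d \<sigma>" "t \<ge> 0"
      unfolding boundary_base_def by blast
    have "{z \<in> topspace Z. f z \<in> U} = {z \<in> topspace Z. ray_from b (f z) t \<in> mball (ray_from b c t) e}"
      using f ct b by (auto simp: U commute ray_from_in Pi_iff)
    then show "openin Z {z \<in> topspace Z. f z \<in> U}"
      using openin_continuous_map_preimage[OF ev[rule_format, OF ct(2)] openin_mball] by simp
  qed
qed

lemma continuous_map_ray_from_at:
  assumes "b \<in> M" "t \<ge> 0"
  shows "continuous_map (boundary_topology M d \<sigma> b) mtopology (\<lambda>c. ray_from b c t)"
  using continuous_map_boundary_iff[OF assms(1), THEN iffD1, OF continuous_map_id] assms(2) by simp

text \<open>Rays are 1-Lipschitz in time, so half of \<open>e\<close> is spent on the change of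
  class at the fixed time \<open>g z\<close> and half on the change of time.\<close>

lemma continuous_map_ray_from:
  assumes b: "b \<in> M" and f: "continuous_map Z (boundary_topology M d \<sigma> b) f"
    and g: "continuous_map Z euclideanreal g" and g0: "\<And>z. z \<in> topspace Z \<Longrightarrow> g z \<ge> 0"
  shows "continuous_map Z mtopology (\<lambda>z. ray_from b (f z) (g z))"
  unfolding continuous_map_to_metric
proof (intro ballI allI impI)
  fix z and e :: real assume z: "z \<in> topspace Z" and e: "e > 0"
  have fb: "f y \<in> boundary M d \<sigma>" if "y \<in> topspace Z" for y
    using f that by (auto simp: continuous_map_def topspace_boundary_topology[OF b])
  have "continuous_map Z mtopology (\<lambda>y. ray_from b (f y) (g z))"
    using f g0[OF z] by (simp add: continuous_map_boundary_iff[OF b])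
  then obtain U where U: "openin Z U" "z \<in> U" "\<And>y. y \<in> U \<Longrightarrow> ray_from b (f y) (g z) \<in> mball (ray_from b (f z) (g z)) (e / 2)"
    using z e unfolding continuous_map_to_metric by (meson half_gt_zero)
  define V where "V = {y \<in> topspace Z. g y \<in> ball (g z) (e / 2)}"
  have "openin Z V"
    unfolding V_def by (rule openin_continuous_map_preimage[OF g]) simp
  moreover have "z \<in> V" using z e by (simp add: V_def)
  moreover have "ray_from b (f y) (g y) \<in> mball (ray_from b (f z) (g z)) e" if "y \<in> U \<inter> V" for y
  proof -
    have y: "y \<in> topspace Z" "\<bar>g z - g y\<bar> < e / 2"
      using that by (auto simp: V_def dist_real_def)
    note ray = ray_from_ray[OF fb[OF y(1)] b]
    have "d (ray_from b (f z) (g z)) (ray_from b (f y) (g y)) \<le>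
        d (ray_from b (f z) (g z)) (ray_from b (f y) (g z)) + d (ray_from b (f y) (g z)) (ray_from b (f y) (g y))"
      using z y by (intro triangle ray_from_in fb b g0)
    also have "\<dots> < e / 2 + e / 2"
      using U(3)[of y] that ray_dist[OF ray g0[OF z] g0[OF y(1)]] y by (intro add_strict_mono) auto
    finally show ?thesis
      using z y ray_in[OF ray] ray_in[OF ray_from_ray[OF fb[OF z] b]] g0 by simp
  qed
  ultimately show "\<exists>U. openin Z U \<and> z \<in> U \<and> (\<forall>y\<in>U. ray_from b (f y) (g y) \<in> mball (ray_from b (f z) (g z)) e)"
    using U(1,2) by (intro exI[of _ "U \<inter> V"]) auto
qed

text \<open>By conicality, a point of the geodesic from \<open>b\<close> depends on the endpoint in
  a 1-Lipschitz way.\<close>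

lemma continuous_map_geodesic_end:
  assumes b: "b \<in> M" and s: "s \<in> {0..1}" and g: "continuous_map Z mtopology g"
  shows "continuous_map Z mtopology (\<lambda>z. \<sigma> b (g z) s)"
  unfolding continuous_map_to_metric
proof (intro ballI allI impI)
  fix z and e :: real assume "z \<in> topspace Z" "e > 0"
  then obtain U where U: "openin Z U" "z \<in> U" "\<And>y. y \<in> U \<Longrightarrow> g y \<in> mball (g z) e"
    using g unfolding continuous_map_to_metric by meson
  have "\<sigma> b (g y) s \<in> mball (\<sigma> b (g z) s) e" if "y \<in> U" for y
  proof -
    have y: "g z \<in> M" "g y \<in> M" "d (g z) (g y) < e"
      using U(3)[OF that] by auto
    have "d (\<sigma> b (g z) s) (\<sigma> b (g y) s) \<le> s * d (g z) (g y)"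
      using conicalD[OF b y(1) b y(2) s] b by simp
    also have "\<dots> \<le> 1 * d (g z) (g y)"
      using s by (intro mult_right_mono) auto
    finally show ?thesis
      using y b s by (simp add: geodesic_in)
  qed
  with U show "\<exists>U. openin Z U \<and> z \<in> U \<and> (\<forall>y\<in>U. \<sigma> b (g y) s \<in> mball (\<sigma> b (g z) s) e)"
    by blast
qed

text \<open>At time \<open>t\<close> the ray from \<open>b'\<close> is approximated by geodesics
  from \<open>b'\<close> to the points at time \<open>n\<close> of the ray from \<open>b\<close>.
  The error is at most \<open>t * d b b' / n\<close>, the same for all classes, and a uniform limit
  of continuous maps is continuous.\<close>

lemma continuous_map_change_base:
  assumes b: "b \<in> M" and b': "b' \<in> M"
  shows "continuous_map (boundary_topology M d \<sigma> b) (boundary_topology M d \<sigma> b') id"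
  unfolding continuous_map_boundary_iff[OF b']
proof (intro conjI allI impI)
  show "id \<in> topspace (boundary_topology M d \<sigma> b) \<rightarrow> boundary M d \<sigma>"
    by (simp add: topspace_boundary_topology[OF b])
  fix t :: real assume t: "t \<ge> 0"
  have ev: "\<forall>\<^sub>F n in sequentially. t \<le> real n \<and> 0 < n"
    using eventually_ge_at_top[of "Suc (nat \<lceil>t\<rceil>)"] by eventually_elim linarith
  have "continuous_map (boundary_topology M d \<sigma> b) mtopology (\<lambda>c. ray_from b' c t)"
  proof (rule continuous_map_uniform_limit_alt)
    show "\<forall>\<^sub>F n in sequentially. continuous_map (boundary_topology M d \<sigma> b) mtopology
        (\<lambda>c. \<sigma> b' (ray_from b c (real n)) (t / real n))"
      using ev
    proof eventually_elim
      case (elim n)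
      with t show ?case
        by (intro continuous_map_geodesic_end[OF b'] continuous_map_ray_from_at[OF b]) auto
    qed
    show "(\<lambda>c. ray_from b' c t) \<in> topspace (boundary_topology M d \<sigma> b) \<rightarrow> M"
      using t b' by (auto simp: topspace_boundary_topology[OF b] ray_from_in)
    fix e :: real assume "e > 0"
    with lim_const_over_n[of "t * d b b'"] have "\<forall>\<^sub>F n in sequentially. t * d b b' / real n < e"
      by (rule order_tendstoD)
    with ev show "\<forall>\<^sub>F n in sequentially. \<forall>c\<in>topspace (boundary_topology M d \<sigma> b).
        d (\<sigma> b' (ray_from b c (real n)) (t / real n)) (ray_from b' c t) < e"
    proof eventually_elim
      case (elim n)
      show ?case
      proof
        fix c assume "c \<in> topspace (boundary_topology M d \<sigma> b)"
        then have c: "c \<in> boundary M d \<sigma>"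
          by (simp add: topspace_boundary_topology[OF b])
        have "d (\<sigma> b' (ray_from b c (real n)) (t / real n)) (ray_from b' c t)
            \<le> t / real n * d (ray_from b c (real n)) (ray_from b' c (real n))"
          using ray_to_point_conical[of "ray_from b' c" b' "ray_from b c n" t n] elim t b' b c
          by (simp add: ray_from_ray ray_from_0 ray_in)
        also have "\<dots> \<le> t / real n * d b b'"
          using asymptotic_dist_le[OF ray_from_asymptotic[OF c b b'], of n] t b b' c
          by (intro mult_left_mono) (auto simp: ray_from_0)
        finally show "d (\<sigma> b' (ray_from b c (real n)) (t / real n)) (ray_from b' c t) < e"
          using elim by simp
      qed
    qed
  qed simp
  then show "continuous_map (boundary_topology M d \<sigma> b) mtopology (\<lambda>z. ray_from b' (id z) t)"
    by simp
qed

lemma boundary_topology_base_independent: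
  assumes "b \<in> M" "b' \<in> M"
  shows "boundary_topology M d \<sigma> b = boundary_topology M d \<sigma> b'"
  using continuous_map_change_base[OF assms] continuous_map_change_base[OF assms(2,1)] assms
  by (metis topology_eq topology_finer_continuous_id topspace_boundary_topology)

text \<open>A class is determined by its ray from \<open>b\<close>, so \<open>ray_from b\<close>
  injects the boundary continuously into a power of \<open>M\<close>. Extensionality of rays makes
  them points of that product.\<close>

lemma Hausdorff_space_boundary:
  assumes b: "b \<in> M"
  shows "Hausdorff_space (boundary_topology M d \<sigma> b)"
proof (rule Hausdorff_space_injective_preimage)
  show "Hausdorff_space (product_topology (\<lambda>_. mtopology) {0::real..})"
    by (simp add: Hausdorff_space_product_topology Hausdorff_space_mtopology)
  show "continuous_map (boundary_topology M d \<sigma> b) (product_topology (\<lambda>_. mtopology) {0..}) (ray_from b)"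
    unfolding continuous_map_componentwise
    using b by (auto simp: continuous_map_ray_from_at topspace_boundary_topology[OF b] ray_extensional ray_from_ray)
  show "inj_on (ray_from b) (topspace (boundary_topology M d \<sigma> b))"
    by (metis b class_ray_from inj_onI topspace_boundary_topology)
qed

text \<open>At time \<open>t\<close> a ray from \<open>b\<close> lies in \<open>mcball b t\<close>,
  so the rays from \<open>b\<close> sit in a product of compact balls. They form a closed subset,
  being cut out by equations between continuous functions of the coordinates, and the boundary is a
  continuous image of it.\<close>

lemma compact_space_boundary:
  assumes b: "b \<in> M" and proper: "proper_space M d"
  shows "compact_space (boundary_topology M d \<sigma> b)"
proof -
  define K where "K = product_topology (\<lambda>t. subtopology mtopology (mcball b t)) {0..}"
  define R where "R = {\<xi> \<in> sigma_rays M d \<sigma>. \<xi> 0 = b}"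
  have compK: "compact_space K"
    unfolding K_def compact_space_product_topology
    using proper b by (auto simp: proper_space_def compactin_subspace)
  have topK: "topspace K = (\<Pi>\<^sub>E t\<in>{0..}. mcball b t)"
    using mcball_subset_mspace by (auto simp: K_def inf_absorb2)
  have proj: "continuous_map K mtopology (\<lambda>\<xi>. \<xi> t)" if "t \<ge> 0" for t
    using that continuous_map_product_projection[of t "{0..}" "\<lambda>t. subtopology mtopology (mcball b t)"]
    by (auto simp: K_def continuous_map_in_subtopology)
  \<comment> \<open>The factor at time 0 is a ball of radius 0. The segment equation can therefore
    be read with the fixed start \<open>b\<close>, where continuity in the endpoint is
    enough.\<close>
  have start: "\<xi> 0 = b" if "\<xi> \<in> topspace K" for \<xi>
  proof -
    have "\<xi> 0 \<in> mcball b 0"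
      using that by (auto simp: topK PiE_iff)
    then show ?thesis
      using nonneg[of b "\<xi> 0"] zero[of b "\<xi> 0"] by auto
  qed
  have RK: "R \<subseteq> topspace K"
  proof
    fix \<xi> assume "\<xi> \<in> R"
    then have "\<xi> \<in> sigma_rays M d \<sigma>" "\<xi> 0 = b" by (auto simp: R_def)
    then show "\<xi> \<in> topspace K"
      using b ray_dist[of \<xi> 0] ray_in[of \<xi>] ray_extensional[of \<xi>] by (fastforce simp: topK PiE_iff)
  qed
  have "R = topspace K \<inter> (\<Inter>(s, t)\<in>{0..} \<times> {0..}. {\<xi> \<in> topspace K. d (\<xi> s) (\<xi> t) = \<bar>s - t\<bar>})
      \<inter> (\<Inter>(s, t)\<in>{0..1} \<times> {0..}. {\<xi> \<in> topspace K. \<sigma> b (\<xi> t) s = \<xi> (s * t)})" (is "R = ?R")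
  proof
    show "R \<subseteq> ?R"
    proof
      fix \<xi> assume "\<xi> \<in> R"
      then have \<xi>: "\<xi> \<in> topspace K" "\<xi> \<in> sigma_rays M d \<sigma>" "\<xi> 0 = b"
        using RK by (auto simp: R_def)
      then show "\<xi> \<in> ?R"
        using ray_dist[OF \<xi>(2)] ray_segment[OF \<xi>(2)] by auto
    qed
    show "?R \<subseteq> R"
    proof
      fix \<xi> assume \<xi>: "\<xi> \<in> ?R"
      then have K: "\<xi> \<in> topspace K" by (rule IntD1[THEN IntD1])
      then have "\<xi> \<in> {0..} \<rightarrow>\<^sub>E M"
        unfolding topK PiE_iff by simp
      moreover have "\<forall>s\<ge>0. \<forall>t\<ge>0. d (\<xi> s) (\<xi> t) = \<bar>s - t\<bar>"
        using \<xi> by simp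
      moreover have "\<forall>t\<ge>0. \<forall>s\<in>{0..1}. \<sigma> (\<xi> 0) (\<xi> t) s = \<xi> (s * t)"
        using \<xi> start[OF K] by simp
      ultimately show "\<xi> \<in> R"
        unfolding R_def sigma_rays_iff using start[OF K] by simp
    qed
  qed
  moreover have "closedin K {\<xi> \<in> topspace K. d (\<xi> s) (\<xi> t) = \<bar>s - t\<bar>}" if "s \<ge> 0" "t \<ge> 0" for s t
  proof (rule closedin_continuous_maps_eq)
    show "continuous_map K euclideanreal (\<lambda>\<xi>. d (\<xi> s) (\<xi> t))"
      using continuous_map_mdist[of K "metric (M, d)"] proj that by simp
  qed auto
  moreover have "closedin K {\<xi> \<in> topspace K. \<sigma> b (\<xi> t) s = \<xi> (s * t)}" if "s \<in> {0..1}" "t \<ge> 0" for s t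
    using that
    by (intro closedin_continuous_maps_eq[OF Hausdorff_space_mtopology] continuous_map_geodesic_end b proj) auto
  ultimately have "closedin K R"
    by (auto intro!: closedin_Int closedin_INT)
  then have compR: "compact_space (subtopology K R)"
    using compK closedin_compact_space compactin_subspace by blast
  let ?class = "\<lambda>\<xi>. asymptotic M d \<sigma> `` {\<xi>}"
  have topR: "topspace (subtopology K R) = R"
    using RK by auto
  have "continuous_map (subtopology K R) (boundary_topology M d \<sigma> b) ?class"
    unfolding continuous_map_boundary_iff[OF b]
  proof (intro conjI allI impI)
    show "?class \<in> topspace (subtopology K R) \<rightarrow> boundary M d \<sigma>"
      unfolding topR by (auto simp: R_def class_in_boundary)
    fix t :: real assume "t \<ge> 0"
    have "\<xi> t = ray_from b (?class \<xi>) t" if "\<xi> \<in> R" for \<xi>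
      using that ray_from_class[of \<xi>] by (auto simp: R_def)
    then show "continuous_map (subtopology K R) mtopology (\<lambda>\<xi>. ray_from b (?class \<xi>) t)"
      by (intro continuous_map_eq[OF continuous_map_from_subtopology[OF proj[OF \<open>t \<ge> 0\<close>]]]) (use topR in blast)
  qed
  then have "compactin (boundary_topology M d \<sigma> b) (?class ` R)"
    using image_compactin compR topR compact_space_def by metis
  moreover have "?class ` R = boundary M d \<sigma>"
  proof
    show "?class ` R \<subseteq> boundary M d \<sigma>"
      by (auto simp: R_def class_in_boundary)
    show "boundary M d \<sigma> \<subseteq> ?class ` R"
    proof
      fix c assume c: "c \<in> boundary M d \<sigma>"
      then have "ray_from b c \<in> R"
        using b by (simp add: R_def ray_from_ray ray_from_0)
      then show "c \<in> ?class ` R"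
        using class_ray_from[OF c b] by (metis imageI)
    qed
  qed
  ultimately show ?thesis
    by (simp add: compact_space_def topspace_boundary_topology[OF b])
qed

end

section \<open>The norm of the product\<close>

text \<open>For positive \<open>u\<close> and \<open>v\<close> this is convexity of the power
  function. If one of them vanishes, it reduces to \<open>c powr q \<le> c\<close> for
  \<open>c\<close> between 0 and 1.\<close>

lemma powr_convex_ge_0:
  fixes q u v w :: real
  assumes "q \<ge> 1" "u \<ge> 0" "v \<ge> 0" "0 \<le> w" "w \<le> 1"
  shows "(w * u + (1 - w) * v) powr q \<le> w * u powr q + (1 - w) * v powr q"
proof -
  have scale: "(c * x) powr q \<le> c * x powr q" if "0 \<le> c" "c \<le> 1" "0 \<le> x" for c x :: real
  proof -
    have "c powr q \<le> c powr 1"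
      using that assms by (intro powr_mono') auto
    then have "c powr q * x powr q \<le> c * x powr q"
      using that by (intro mult_right_mono) auto
    then show ?thesis
      using that by (simp add: powr_mult)
  qed
  consider "u = 0" | "v = 0" | "u > 0" "v > 0"
    using assms by linarith
  then show ?thesis
  proof cases
    case 1
    then show ?thesis using scale[of "1 - w" v] assms by simp
  next
    case 2
    then show ?thesis using scale[of w u] assms by simp
  next
    case 3
    then show ?thesis
      using convex_onD[OF powr_convex[OF assms(1)], of "1 - w" u v] assms by simp
  qed
qed

lemma lp_norm2_eq_max: "lp_norm2 \<infinity> a b = max \<bar>a\<bar> \<bar>b\<bar>"
  by (simp add: lp_norm2_def)

lemma lp_norm2_eq_powr:
  "q \<ge> 1 \<Longrightarrow> lp_norm2 (ereal q) a b = (\<bar>a\<bar> powr q + \<bar>b\<bar> powr q) powr (1 / q)"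
  by (simp add: lp_norm2_def)

lemma ereal_ge_1_cases:
  fixes p :: ereal
  assumes "1 \<le> p"
  obtains "p = \<infinity>" | q where "p = ereal q" "q \<ge> 1"
  using assms by (cases p) auto

lemma lp_norm2_nonneg: "1 \<le> p \<Longrightarrow> 0 \<le> lp_norm2 p a b"
  by (auto simp: lp_norm2_def)

lemma lp_norm2_scale:
  assumes "1 \<le> p" "0 \<le> c"
  shows "lp_norm2 p (c * a) (c * b) = c * lp_norm2 p a b"
  using assms(1)
proof (cases rule: ereal_ge_1_cases)
  case 1
  then show ?thesis
    using assms by (simp add: lp_norm2_eq_max abs_mult max_mult_distrib_left)
next
  case (2 q)
  have "\<bar>c * a\<bar> powr q + \<bar>c * b\<bar> powr q = c powr q * (\<bar>a\<bar> powr q + \<bar>b\<bar> powr q)"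
    using assms by (simp add: abs_mult powr_mult distrib_left)
  then show ?thesis
    using 2 assms by (simp add: lp_norm2_eq_powr powr_mult powr_powr)
qed

lemma lp_norm2_mono:
  assumes "1 \<le> p" "0 \<le> a" "a \<le> a'" "0 \<le> b" "b \<le> b'"
  shows "lp_norm2 p a b \<le> lp_norm2 p a' b'"
  using assms(1)
  by (cases rule: ereal_ge_1_cases)
    (use assms in \<open>auto simp: lp_norm2_eq_max lp_norm2_eq_powr intro!: powr_mono2 add_mono\<close>)

lemma lp_norm2_axis:
  assumes "1 \<le> p"
  shows "lp_norm2 p a 0 = \<bar>a\<bar>" "lp_norm2 p 0 b = \<bar>b\<bar>"
  using assms
  by (cases rule: ereal_ge_1_cases; simp add: lp_norm2_eq_max lp_norm2_eq_powr powr_powr)+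

lemma lp_norm2_abs: "lp_norm2 p \<bar>a\<bar> \<bar>b\<bar> = lp_norm2 p a b"
  by (simp add: lp_norm2_def)

lemma lp_norm2_ge:
  assumes "1 \<le> p"
  shows "\<bar>a\<bar> \<le> lp_norm2 p a b" "\<bar>b\<bar> \<le> lp_norm2 p a b"
  using lp_norm2_mono[OF assms, of "\<bar>a\<bar>" "\<bar>a\<bar>" 0 "\<bar>b\<bar>"] lp_norm2_mono[OF assms, of 0 "\<bar>a\<bar>" "\<bar>b\<bar>" "\<bar>b\<bar>"]
  by (simp_all add: lp_norm2_axis assms lp_norm2_abs)

lemma lp_norm2_eq_0_iff: "1 \<le> p \<Longrightarrow> lp_norm2 p a b = 0 \<longleftrightarrow> a = 0 \<and> b = 0"
  using lp_norm2_ge[of p a b] lp_norm2_ge[of p b a] lp_norm2_axis[of p 0] by auto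

text \<open>Minkowski's inequality in the plane, from convexity of the unit ball: for nonzero norms,
  \<open>(a + a', b + b')\<close> divided by \<open>A + B\<close> is a convex combination of the two
  normalised vectors.\<close>

lemma lp_norm2_triangle:
  assumes p: "1 \<le> p" and nonneg: "0 \<le> a" "0 \<le> b" "0 \<le> a'" "0 \<le> b'"
  shows "lp_norm2 p (a + a') (b + b') \<le> lp_norm2 p a b + lp_norm2 p a' b'"
  using p
proof (cases rule: ereal_ge_1_cases)
  case 1
  then show ?thesis
    using nonneg by (auto simp: lp_norm2_eq_max)
next
  case (2 q)
  define A B where "A = lp_norm2 p a b" and "B = lp_norm2 p a' b'"
  have AB: "A \<ge> 0" "B \<ge> 0"
    using p by (auto simp: A_def B_def lp_norm2_nonneg)
  show ?thesis
  proof (cases "A = 0 \<or> B = 0")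
    case True
    then show ?thesis
      using p by (auto simp: A_def B_def lp_norm2_eq_0_iff lp_norm2_nonneg)
  next
    case False
    with AB have pos: "A > 0" "B > 0" by auto
    have unit: "(x / C) powr q + (y / C) powr q = 1"
      if C: "C = lp_norm2 p x y" "C > 0" and xy: "x \<ge> 0" "y \<ge> 0" for x y C
    proof -
      have "lp_norm2 p (x / C) (y / C) = 1"
        using lp_norm2_scale[OF p, of "1 / C" x y] C by simp
      then have "((x / C) powr q + (y / C) powr q) powr (1 / q) = 1"
        using 2 xy C(2) by (simp add: lp_norm2_eq_powr)
      then have "(((x / C) powr q + (y / C) powr q) powr (1 / q)) powr q = 1"
        by simp
      then show ?thesis
        using 2 by (simp add: powr_powr)
    qed
    \<comment> \<open>With the share of the first norm as weight, dividing the sum by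
      \<open>A + B\<close> normalises each summand by its own norm.\<close>
    define w where "w = A / (A + B)"
    have w: "0 \<le> w" "w \<le> 1" "1 - w = B / (A + B)"
      using pos by (auto simp: w_def field_simps)
    have split: "(x + x') / (A + B) = w * (x / A) + (1 - w) * (x' / B)" for x x'
      using pos unfolding w(3) by (simp add: w_def add_divide_distrib)
    have "((a + a') / (A + B)) powr q + ((b + b') / (A + B)) powr q
        \<le> (w * (a / A) powr q + (1 - w) * (a' / B) powr q) + (w * (b / A) powr q + (1 - w) * (b' / B) powr q)"
      unfolding split using 2 nonneg pos w by (intro add_mono powr_convex_ge_0) auto
    also have "\<dots> = w * ((a / A) powr q + (b / A) powr q) + (1 - w) * ((a' / B) powr q + (b' / B) powr q)"
      by (simp add: algebra_simps)
    also have "\<dots> = 1"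
      using unit[OF A_def pos(1) nonneg(1,2)] unit[OF B_def pos(2) nonneg(3,4)] by simp
    finally have "lp_norm2 p ((a + a') / (A + B)) ((b + b') / (A + B)) \<le> 1"
      using 2 nonneg pos by (simp add: lp_norm2_eq_powr powr_le1)
    then have "(A + B) * lp_norm2 p ((a + a') / (A + B)) ((b + b') / (A + B)) \<le> A + B"
      using pos by (simp add: mult_left_le)
    then show ?thesis
      using lp_norm2_scale[OF p, of "A + B" "(a + a') / (A + B)" "(b + b') / (A + B)"] pos
      by (simp add: A_def[symmetric] B_def[symmetric])
  qed
qed

lemma lp_norm2_le_add:
  assumes "1 \<le> p" "0 \<le> a" "0 \<le> b"
  shows "lp_norm2 p a b \<le> a + b"
  using lp_norm2_triangle[OF assms(1), of a 0 0 b] assms by (simp add: lp_norm2_axis)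

lemma continuous_on_lp_norm2:
  assumes "1 \<le> p" "continuous_on S f" "continuous_on S g"
  shows "continuous_on S (\<lambda>s. lp_norm2 p (f s) (g s))"
  using assms(1)
proof (cases rule: ereal_ge_1_cases)
  case 1
  then show ?thesis
    using assms by (auto simp: lp_norm2_eq_max intro!: continuous_intros)
next
  case (2 q)
  then have "continuous_on S (\<lambda>s. (\<bar>f s\<bar> powr q + \<bar>g s\<bar> powr q) powr (1 / q))"
    using assms by (intro continuous_on_powr' continuous_intros) auto
  then show ?thesis
    using 2 by (simp add: lp_norm2_eq_powr)
qed

section \<open>The product bicombing\<close>

lemma lp_prod_dist_Pair: "lp_prod_dist p dX dY (x, y) (x', y') = lp_norm2 p (dX x x') (dY y y')"
  by (simp add: lp_prod_dist_def)

lemma prod_bicombing_Pair: "prod_bicombing \<sigma>X \<sigma>Y (x, y) (x', y') t = (\<sigma>X x x' t, \<sigma>Y y y' t)"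
  by (simp add: prod_bicombing_def)

section \<open>Comparison with the Euclidean product metric\<close>

lemma openin_mtopology_mono:
  assumes "Metric_space M d1" "Metric_space M d2"
    and C: "C > 0" and le: "\<And>x y. x \<in> M \<Longrightarrow> y \<in> M \<Longrightarrow> d1 x y \<le> C * d2 x y"
    and U: "openin (Metric_space.mtopology M d1) U"
  shows "openin (Metric_space.mtopology M d2) U"
proof -
  interpret M1: Metric_space M d1 by fact
  interpret M2: Metric_space M d2 by fact
  show ?thesis
    unfolding M2.openin_mtopology
  proof (intro conjI allI impI)
    show "U \<subseteq> M" using U by (simp add: M1.openin_mtopology)
    fix x assume "x \<in> U"
    then obtain r where r: "r > 0" "M1.mball x r \<subseteq> U"
      using U by (auto simp: M1.openin_mtopology)
    have "M2.mball x (r / C) \<subseteq> M1.mball x r"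
    proof
      fix y assume "y \<in> M2.mball x (r / C)"
      then have y: "x \<in> M" "y \<in> M" "C * d2 x y < r"
        using C by (auto simp: field_simps)
      with le[of x y] show "y \<in> M1.mball x r" by simp
    qed
    with r C show "\<exists>r>0. M2.mball x r \<subseteq> U"
      by (intro exI[of _ "r / C"]) auto
  qed
qed

locale lp_product = Metric_space12 X dX Y dY
  for X :: "'a set" and dX and Y :: "'b set" and dY +
  fixes p :: ereal
  assumes p: "1 \<le> p"
begin

sublocale lp: Metric_space "X \<times> Y" "lp_prod_dist p dX dY"
proof
  fix z z' :: "'a \<times> 'b"
  obtain x y x' y' where z: "z = (x, y)" "z' = (x', y')" by (metis surj_pair)
  show "0 \<le> lp_prod_dist p dX dY z z'"
    using p by (simp add: z lp_prod_dist_Pair lp_norm2_nonneg)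
  show "lp_prod_dist p dX dY z z' = lp_prod_dist p dX dY z' z"
    by (simp add: z lp_prod_dist_Pair M1.commute M2.commute)
  show "lp_prod_dist p dX dY z z' = 0 \<longleftrightarrow> z = z'" if "z \<in> X \<times> Y" "z' \<in> X \<times> Y"
    using that p by (simp add: z lp_prod_dist_Pair lp_norm2_eq_0_iff)
  fix z'' assume M: "z \<in> X \<times> Y" "z' \<in> X \<times> Y" "z'' \<in> X \<times> Y"
  obtain x'' y'' where z'': "z'' = (x'', y'')" by (metis surj_pair)
  have "lp_norm2 p (dX x x'') (dY y y'') \<le> lp_norm2 p (dX x x' + dX x' x'') (dY y y' + dY y' y'')"
    using M p by (intro lp_norm2_mono M1.triangle M2.triangle) (auto simp: z z'')
  also have "\<dots> \<le> lp_norm2 p (dX x x') (dY y y') + lp_norm2 p (dX x' x'') (dY y' y'')"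
    using p by (intro lp_norm2_triangle) auto
  finally show "lp_prod_dist p dX dY z z'' \<le> lp_prod_dist p dX dY z z' + lp_prod_dist p dX dY z' z''"
    by (simp add: z z'' lp_prod_dist_Pair)
qed

text \<open>Each metric is at most the sum of the component distances, and that sum is at most twice
  a metric dominating both components; hence the constant 2.\<close>

lemma lp_prod_dist_compare:
  assumes "z \<in> X \<times> Y" "z' \<in> X \<times> Y"
  shows "lp_prod_dist p dX dY z z' \<le> 2 * prod_dist dX dY z z'"
    and "prod_dist dX dY z z' \<le> 2 * lp_prod_dist p dX dY z z'"
proof -
  obtain x y x' y' where z: "z = (x, y)" "z' = (x', y')" by (metis surj_pair)
  show "lp_prod_dist p dX dY z z' \<le> 2 * prod_dist dX dY z z'"
    using lp_norm2_le_add[OF p, of "dX x x'" "dY y y'"] component_le_prod_metric[where ?x1.0 = x and ?x2.0 = x' and ?y1.0 = y and ?y2.0 = y']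
    by (simp add: z lp_prod_dist_Pair)
  show "prod_dist dX dY z z' \<le> 2 * lp_prod_dist p dX dY z z'"
    using lp_norm2_ge[OF p, where a = "dX x x'" and b = "dY y y'"] prod_metric_le_components[where ?x1.0 = x and ?y1.0 = x' and ?x2.0 = y and ?y2.0 = y'] assms
    by (simp add: z lp_prod_dist_Pair)
qed

lemma mtopology_lp_prod: "lp.mtopology = prod_topology M1.mtopology M2.mtopology"
proof -
  have "lp.mtopology = Prod_metric.mtopology"
    unfolding topology_eq
    using openin_mtopology_mono[OF lp.Metric_space_axioms Prod_metric.Metric_space_axioms zero_less_numeral]
      openin_mtopology_mono[OF Prod_metric.Metric_space_axioms lp.Metric_space_axioms zero_less_numeral]
      lp_prod_dist_compare
    by blast
  then show ?thesis
    by (simp add: mtopology_prod_metric)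
qed

lemma mcomplete_lp_prod:
  assumes "M1.mcomplete" "M2.mcomplete"
  shows "lp.mcomplete"
  unfolding lp.mcomplete_def
proof (intro allI impI)
  fix f assume f: "lp.MCauchy f"
  have "Prod_metric.MCauchy f"
    unfolding Prod_metric.MCauchy_def
  proof (intro conjI allI impI)
    show ran: "range f \<subseteq> X \<times> Y" using f by (simp add: lp.MCauchy_def)
    fix e :: real assume "e > 0"
    then obtain N where N: "\<And>n n'. N \<le> n \<Longrightarrow> N \<le> n' \<Longrightarrow> lp_prod_dist p dX dY (f n) (f n') < e / 2"
      using f unfolding lp.MCauchy_def by (meson half_gt_zero)
    have "prod_dist dX dY (f n) (f n') < e" if "N \<le> n" "N \<le> n'" for n n'
      using N[OF that] lp_prod_dist_compare(2)[of "f n" "f n'"] ran by (simp add: range_subsetD)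
    then show "\<exists>N. \<forall>n n'. N \<le> n \<longrightarrow> N \<le> n' \<longrightarrow> prod_dist dX dY (f n) (f n') < e"
      by blast
  qed
  moreover have "Prod_metric.mcomplete"
    using assms by (simp add: mcomplete_prod_metric)
  ultimately show "\<exists>z. limitin lp.mtopology f z sequentially"
    unfolding Prod_metric.mcomplete_def by (simp add: mtopology_lp_prod mtopology_prod_metric)
qed

end

text \<open>Initial segments pass to the product component by component. For conicality,
  monotonicity of the norm inserts the two factor inequalities, the triangle inequality separates
  the contributions of starts and ends, and homogeneity pulls out \<open>1 - t\<close> and
  \<open>t\<close>.\<close>

lemma conical_bicombing_lp_prod:
  assumes p: "1 \<le> p" and "conical_bicombing X dX \<sigma>X" and "conical_bicombing Y dY \<sigma>Y"
  shows "conical_bicombing (X \<times> Y) (lp_prod_dist p dX dY) (prod_bicombing \<sigma>X \<sigma>Y)"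
proof -
  interpret X: conical_bicombing X dX \<sigma>X by fact
  interpret Y: conical_bicombing Y dY \<sigma>Y by fact
  interpret lp_product X dX Y dY p by unfold_locales (rule p)
  show ?thesis
  proof
    show "lp.mcomplete"
      using X.complete Y.complete by (rule mcomplete_lp_prod)
  next
    fix z z' assume "z \<in> X \<times> Y" "z' \<in> X \<times> Y"
    then obtain x y x' y' where z: "z = (x, y)" "z' = (x', y')" and M: "x \<in> X" "x' \<in> X" "y \<in> Y" "y' \<in> Y"
      by blast
    show "const_speed_geodesic (X \<times> Y) (lp_prod_dist p dX dY) (prod_bicombing \<sigma>X \<sigma>Y z z') z z'"
      using M p
      by (auto simp: const_speed_geodesic_def z prod_bicombing_Pair lp_prod_dist_Pair X.geodesic_simps
          Y.geodesic_simps lp_norm2_scale)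
    fix s t :: real assume "s \<in> {0..1}" "t \<in> {0..1}"
    then show "prod_bicombing \<sigma>X \<sigma>Y z (prod_bicombing \<sigma>X \<sigma>Y z z' t) s = prod_bicombing \<sigma>X \<sigma>Y z z' (s * t)"
      using M by (simp add: z prod_bicombing_Pair X.initial_segment Y.initial_segment)
  next
    show "conical (X \<times> Y) (lp_prod_dist p dX dY) (prod_bicombing \<sigma>X \<sigma>Y)"
      unfolding conical_def
    proof (intro ballI)
      fix z1 z2 z3 z4 and t :: real
      assume "z1 \<in> X \<times> Y" "z2 \<in> X \<times> Y" "z3 \<in> X \<times> Y" "z4 \<in> X \<times> Y" and t: "t \<in> {0..1}"
      then obtain x1 y1 x2 y2 x3 y3 x4 y4 where z: "z1 = (x1, y1)" "z2 = (x2, y2)" "z3 = (x3, y3)" "z4 = (x4, y4)"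
        and M: "x1 \<in> X" "x2 \<in> X" "x3 \<in> X" "x4 \<in> X" "y1 \<in> Y" "y2 \<in> Y" "y3 \<in> Y" "y4 \<in> Y"
        by blast
      have "lp_norm2 p (dX (\<sigma>X x1 x2 t) (\<sigma>X x3 x4 t)) (dY (\<sigma>Y y1 y2 t) (\<sigma>Y y3 y4 t))
          \<le> lp_norm2 p ((1 - t) * dX x1 x3 + t * dX x2 x4) ((1 - t) * dY y1 y3 + t * dY y2 y4)"
        using p M t by (intro lp_norm2_mono X.conicalD Y.conicalD) auto
      also have "\<dots> \<le> lp_norm2 p ((1 - t) * dX x1 x3) ((1 - t) * dY y1 y3) + lp_norm2 p (t * dX x2 x4) (t * dY y2 y4)"
        using p t by (intro lp_norm2_triangle) auto
      also have "\<dots> = (1 - t) * lp_norm2 p (dX x1 x3) (dY y1 y3) + t * lp_norm2 p (dX x2 x4) (dY y2 y4)"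
        using p t by (simp add: lp_norm2_scale)
      finally show "lp_prod_dist p dX dY (prod_bicombing \<sigma>X \<sigma>Y z1 z2 t) (prod_bicombing \<sigma>X \<sigma>Y z3 z4 t)
          \<le> (1 - t) * lp_prod_dist p dX dY z1 z3 + t * lp_prod_dist p dX dY z2 z4"
        by (simp add: z prod_bicombing_Pair lp_prod_dist_Pair)
    qed
  qed
qed

section \<open>From proper spaces and consistent bicombings to the locale\<close>

lemma proper_imp_mcomplete:
  assumes "Metric_space M d" "proper_space M d"
  shows "Metric_space.mcomplete M d"
proof -
  interpret Metric_space M d by fact
  show ?thesis
    unfolding mcomplete_def
  proof (intro allI impI)
    fix f assume f: "MCauchy f"
    then have "mbounded (range f)"
      by (rule MCauchy_imp_mbounded)
    then obtain x r where xr: "range f \<subseteq> mcball x r"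
      by (auto simp: mbounded_def)
    then have "x \<in> M" by (force simp: image_subset_iff)
    then have "compactin mtopology (mcball x r)"
      using assms(2) by (auto simp: proper_space_def)
    with xr obtain l s where "strict_mono s" "limitin mtopology (f \<circ> s) l sequentially"
      unfolding compactin_sequentially by blast
    then show "\<exists>x. limitin mtopology f x sequentially"
      using MCauchy_convergent_subsequence[OF f] by blast
  qed
qed

text \<open>Consistency from parameter 0 on equates two images; the distance from \<open>x\<close>
  then identifies the parameters.\<close>

lemma conical_bicombing_if_proper:
  assumes "Metric_space M d" and "proper_space M d"
    and "bicombing M d \<sigma>" and "consistent M \<sigma>" and "conical M d \<sigma>"
  shows "conical_bicombing M d \<sigma>"
proof -
  interpret Metric_space M d by fact
  have geod: "const_speed_geodesic M d (\<sigma> x y) x y" if "x \<in> M" "y \<in> M" for x y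
    using assms(3) that by (simp add: bicombing_def)
  show ?thesis
  proof
    show mcomplete
      using assms(1,2) by (rule proper_imp_mcomplete)
  next
    fix x y assume M: "x \<in> M" "y \<in> M"
    show "const_speed_geodesic M d (\<sigma> x y) x y"
      using geod[OF M] .
    fix s t :: real assume st: "s \<in> {0..1}" "t \<in> {0..1}"
    note g = geod[OF M, unfolded const_speed_geodesic_def]
    have dist: "d x (\<sigma> x y u) = u * d x y" if "u \<in> {0..1}" for u
      using g that by (metis abs_minus_commute abs_of_nonneg atLeastAtMost_iff diff_zero order_refl zero_le_one)
    have in_M: "\<sigma> x y u \<in> M" if "u \<in> {0..1}" for u
      using g that by auto
    note g' = geod[OF M(1) in_M[OF st(2)], unfolded const_speed_geodesic_def]
    have dist': "d x (\<sigma> x (\<sigma> x y t) s) = s * (t * d x y)"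
      using g' st dist[OF st(2)]
      by (metis abs_minus_commute abs_of_nonneg atLeastAtMost_iff diff_zero order_refl zero_le_one)
    show "\<sigma> x (\<sigma> x y t) s = \<sigma> x y (s * t)"
    \<comment> \<open>If the product vanishes, either consistency does not apply or distances do not
      separate parameters, but then both points are \<open>x\<close>.\<close>
    proof (cases "t * d x y = 0")
      case True
      have s_t: "s * t \<in> {0..1}"
        using st by (auto simp: mult_le_one)
      have "\<sigma> x (\<sigma> x y t) s \<in> M"
        using g' st by blast
      then have "\<sigma> x (\<sigma> x y t) s = x"
        using dist' True zero[OF M(1), of "\<sigma> x (\<sigma> x y t) s"] by simp
      moreover have "\<sigma> x y (s * t) = x"
        using dist[OF s_t] True zero[OF M(1) in_M[OF s_t]] by auto
      ultimately show ?thesis by simp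
    next
      case False
      then have t: "0 < t" "d x y \<noteq> 0" using st by auto
      then have "\<sigma> x (\<sigma> x y t) ` {0..1} = \<sigma> x y ` {0..t}"
        using assms(4) M st g unfolding consistent_def by (metis atLeastAtMost_iff order_refl)
      then have "\<sigma> x (\<sigma> x y t) s \<in> \<sigma> x y ` {0..t}"
        using st by (metis imageI)
      then obtain u where u: "u \<in> {0..t}" "\<sigma> x (\<sigma> x y t) s = \<sigma> x y u"
        by blast
      then have "u * d x y = s * (t * d x y)"
        using dist[of u] dist' st by auto
      with t u show ?thesis by simp
    qed
  qed (rule assms(5))
qed

section \<open>Rays in the product\<close>

text \<open>The components of a ray in a product have constant but arbitrary speed, possibly \<open>0\<close>.\<close>

definition linear_ray ::
  "'a set \<Rightarrow> ('a \<Rightarrow> 'a \<Rightarrow> real) \<Rightarrow> ('a \<Rightarrow> 'a \<Rightarrow> real \<Rightarrow> 'a) \<Rightarrow> real \<Rightarrow> (real \<Rightarrow> 'a) \<Rightarrow> bool" where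
  "linear_ray M d \<sigma> a \<xi> \<longleftrightarrow>
     \<xi> \<in> {0..} \<rightarrow> M \<and> (\<forall>s\<ge>0. \<forall>t\<ge>0. d (\<xi> s) (\<xi> t) = a * \<bar>s - t\<bar>) \<and>
     (\<forall>t\<ge>0. \<forall>s\<in>{0..1}. \<sigma> (\<xi> 0) (\<xi> t) s = \<xi> (s * t))"

context conical_bicombing
begin

lemma linear_ray_nonneg: "linear_ray M d \<sigma> a \<xi> \<Longrightarrow> 0 \<le> a"
  using nonneg[of "\<xi> 0" "\<xi> 1"] by (simp add: linear_ray_def)

lemma linear_ray_scale:
  assumes "\<xi> \<in> sigma_rays M d \<sigma>" "a \<ge> 0"
  shows "linear_ray M d \<sigma> a (\<lambda>t. \<xi> (a * t))"
proof -
  have "\<bar>a * s - a * t\<bar> = a * \<bar>s - t\<bar>" for s t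
    using assms(2) by (simp add: abs_mult right_diff_distrib[symmetric])
  then show ?thesis
    using assms ray_in[OF assms(1)] ray_dist[OF assms(1)] ray_segment[OF assms(1)]
    by (auto simp: linear_ray_def mult.left_commute)
qed

lemma linear_ray_const:
  assumes "b \<in> M"
  shows "linear_ray M d \<sigma> 0 (\<lambda>_. b)"
proof -
  have "\<sigma> b b s = b" if "s \<in> {0..1}" for s
    using geodesic_dist_start[OF assms assms that] geodesic_in[OF assms assms that] assms
      zero[of b "\<sigma> b b s"] by simp
  then show ?thesis
    using assms by (auto simp: linear_ray_def)
qed

lemma linear_ray_0:
  assumes "linear_ray M d \<sigma> 0 \<xi>" "t \<ge> 0"
  shows "\<xi> t = \<xi> 0"
  using assms zero[of "\<xi> t" "\<xi> 0"] by (auto simp: linear_ray_def Pi_iff)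

text \<open>Rescaling time by \<open>1 / a\<close> gives unit speed; \<open>c\<close> is the class
  of the resulting ray.\<close>

lemma linear_ray_eq_ray_from:
  assumes \<xi>: "linear_ray M d \<sigma> a \<xi>" and "a > 0"
  obtains c where "c \<in> boundary M d \<sigma>" "\<And>t. t \<ge> 0 \<Longrightarrow> \<xi> t = ray_from (\<xi> 0) c (a * t)"
proof -
  define \<eta> where "\<eta> = restrict (\<lambda>t. \<xi> (t / a)) {0..}"
  have "a * \<bar>s / a - t / a\<bar> = \<bar>s - t\<bar>" for s t
    using \<open>a > 0\<close> by (simp add: diff_divide_distrib[symmetric])
  then have "\<eta> \<in> sigma_rays M d \<sigma>"
    using \<xi> \<open>a > 0\<close> unfolding sigma_rays_iff linear_ray_def
    by (auto simp: \<eta>_def)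
  moreover have "\<eta> 0 = \<xi> 0"
    by (simp add: \<eta>_def)
  ultimately have "ray_from (\<xi> 0) (asymptotic M d \<sigma> `` {\<eta>}) = \<eta>" "asymptotic M d \<sigma> `` {\<eta>} \<in> boundary M d \<sigma>"
    using ray_from_class[of \<eta>] class_in_boundary by auto
  moreover have "\<xi> t = \<eta> (a * t)" if "t \<ge> 0" for t
    using that \<open>a > 0\<close> by (simp add: \<eta>_def)
  ultimately show thesis
    using that by metis
qed

text \<open>The speed is the distance from \<open>b\<close> at time 1. A positive speed allows
  rescaling time and so recovers the whole ray and its class, while speed 0 shows only the point
  \<open>b\<close>. This matches the identifications at the two ends of the join.\<close>

lemma ray_from_scale_eqD:
  assumes c: "c \<in> boundary M d \<sigma>" "c' \<in> boundary M d \<sigma>" and b: "b \<in> M" and a: "a \<ge> 0" "a' \<ge> 0"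
    and eq: "\<And>t. t \<ge> 0 \<Longrightarrow> ray_from b c (a * t) = ray_from b c' (a' * t)"
  shows "a = a'" and "a > 0 \<Longrightarrow> c = c'"
proof -
  note r = ray_from_ray[OF c(1) b] and r' = ray_from_ray[OF c(2) b]
  have "d b (ray_from b c (a * 1)) = a" "d b (ray_from b c' (a' * 1)) = a'"
    using ray_dist[OF r, of 0 a] ray_dist[OF r', of 0 a'] a c b by (auto simp: ray_from_0)
  with eq[of 1] show aa: "a = a'" by simp
  assume "a > 0"
  have "ray_from b c t = ray_from b c' t" for t
  proof (cases "t \<ge> 0")
    case True
    then show ?thesis
      using eq[of "t / a"] aa \<open>a > 0\<close> by simp
  next
    case False
    then show ?thesis
      using ray_extensional[OF r] ray_extensional[OF r'] by (simp add: extensional_def)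
  qed
  then have "ray_from b c = ray_from b c'" by blast
  then show "c = c'"
    using class_ray_from[OF c(1) b] class_ray_from[OF c(2) b] by metis
qed

end

text \<open>As the fibres agree, each quotient map factors through the other, and the two induced
  maps are mutually inverse.\<close>

lemma homeomorphic_space_quotients:
  assumes f: "quotient_map W A f" and g: "quotient_map W B g"
    and fibres: "\<And>w w'. \<lbrakk>w \<in> topspace W; w' \<in> topspace W\<rbrakk> \<Longrightarrow> f w = f w' \<longleftrightarrow> g w = g w'"
  shows "A homeomorphic_space B"
proof -
  have fg: "g w = g w'" if "w \<in> topspace W" "w' \<in> topspace W" "f w = f w'" for w w'
    using fibres[OF that(1,2)] that(3) by simp
  have gf: "f w = f w'" if "w \<in> topspace W" "w' \<in> topspace W" "g w = g w'" for w w'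
    using fibres[OF that(1,2)] that(3) by simp
  have "\<exists>h. continuous_map A B h \<and> (\<forall>w\<in>topspace W. h (f w) = g w)"
    by (rule quotient_map_lift_exists[OF f quotient_imp_continuous_map[OF g]], rule fg) blast+
  moreover have "\<exists>k. continuous_map B A k \<and> (\<forall>w\<in>topspace W. k (g w) = f w)"
    by (rule quotient_map_lift_exists[OF g quotient_imp_continuous_map[OF f]], rule gf) blast+
  ultimately obtain h k where h: "continuous_map A B h" "\<forall>w\<in>topspace W. h (f w) = g w"
    and k: "continuous_map B A k" "\<forall>w\<in>topspace W. k (g w) = f w"
    by blast
  have "homeomorphic_maps A B h k"
    unfolding homeomorphic_maps_def
    using h k quotient_imp_surjective_map[OF f, symmetric] quotient_imp_surjective_map[OF g, symmetric] by auto
  then show ?thesis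
    by (auto simp: homeomorphic_space_def)
qed

lemma prod_sigma_rayI:
  assumes p: "1 \<le> p" and "conical_bicombing X dX \<sigma>X" and "conical_bicombing Y dY \<sigma>Y"
    and \<xi>: "linear_ray X dX \<sigma>X a \<xi>" and \<eta>: "linear_ray Y dY \<sigma>Y b \<eta>" and ab: "lp_norm2 p a b = 1"
  shows "restrict (\<lambda>t. (\<xi> t, \<eta> t)) {0..} \<in> sigma_rays (X \<times> Y) (lp_prod_dist p dX dY) (prod_bicombing \<sigma>X \<sigma>Y)"
proof -
  interpret Z: conical_bicombing "X \<times> Y" "lp_prod_dist p dX dY" "prod_bicombing \<sigma>X \<sigma>Y"
    using assms by (intro conical_bicombing_lp_prod)
  have "lp_norm2 p (a * \<bar>s - t\<bar>) (b * \<bar>s - t\<bar>) = \<bar>s - t\<bar>" for s t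
    using lp_norm2_scale[OF p, of "\<bar>s - t\<bar>" a b] ab by (simp add: mult.commute)
  then show ?thesis
    using \<xi> \<eta> unfolding Z.sigma_rays_iff linear_ray_def
    by (auto simp: lp_prod_dist_Pair prod_bicombing_Pair)
qed

text \<open>Each component inherits the segment equation, which alone forces constant speed. The
  speeds are the distances that the components cover between times 0 and 1.\<close>

lemma prod_sigma_rayE:
  assumes p: "1 \<le> p" and cX: "conical_bicombing X dX \<sigma>X" and cY: "conical_bicombing Y dY \<sigma>Y"
    and \<zeta>: "\<zeta> \<in> sigma_rays (X \<times> Y) (lp_prod_dist p dX dY) (prod_bicombing \<sigma>X \<sigma>Y)"
  obtains \<xi> \<eta> a b where "linear_ray X dX \<sigma>X a \<xi>" "linear_ray Y dY \<sigma>Y b \<eta>" "lp_norm2 p a b = 1"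
    "\<zeta> = restrict (\<lambda>t. (\<xi> t, \<eta> t)) {0..}"
proof -
  interpret Z: conical_bicombing "X \<times> Y" "lp_prod_dist p dX dY" "prod_bicombing \<sigma>X \<sigma>Y"
    using assms by (intro conical_bicombing_lp_prod)
  have *: "linear_ray M d \<sigma> (d (\<xi> 0) (\<xi> 1)) \<xi>"
    if "conical_bicombing M d \<sigma>" and in_M: "\<And>t. t \<ge> 0 \<Longrightarrow> \<xi> t \<in> M"
      and seg: "\<And>s t. t \<ge> 0 \<Longrightarrow> s \<in> {0..1} \<Longrightarrow> \<sigma> (\<xi> 0) (\<xi> t) s = \<xi> (s * t)"
    for M :: "'c set" and d \<sigma> \<xi>
  proof -
    interpret conical_bicombing M d \<sigma> by fact
    have start: "d (\<xi> 0) (\<xi> (s * t)) = s * d (\<xi> 0) (\<xi> t)" if "t \<ge> 0" "s \<in> {0..1}" for s t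
      using geodesic_dist_start[of "\<xi> 0" "\<xi> t" s] seg[OF that] in_M that by simp
    \<comment> \<open>Distance from the start is homogeneous in time. Time 1 fixes the factor: it is
      scaled down to \<open>t\<close> if \<open>t \<le> 1\<close>, and \<open>t\<close> is scaled
      down to it otherwise.\<close>
    have speed: "d (\<xi> 0) (\<xi> t) = d (\<xi> 0) (\<xi> 1) * t" if "t \<ge> 0" for t
    proof (cases "t \<le> 1")
      case True
      then show ?thesis using start[of 1 t] that by simp
    next
      case False
      then show ?thesis using start[of t "1 / t"] by simp
    qed
    \<comment> \<open>Both points lie on the geodesic from \<open>\<xi> 0\<close> to
      \<open>\<xi> t\<close>, at the parameters \<open>s / t\<close> and 1.\<close>
    have le: "d (\<xi> s) (\<xi> t) = d (\<xi> 0) (\<xi> 1) * \<bar>s - t\<bar>" if "0 \<le> s" "s \<le> t" for s t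
    proof (cases "t = 0")
      case False
      then have "d (\<xi> s) (\<xi> t) = \<bar>s / t - 1\<bar> * d (\<xi> 0) (\<xi> t)"
        using geodesic_dist[of "\<xi> 0" "\<xi> t" "s / t" 1] seg[of t "s / t"] seg[of t 1] in_M that by simp
      also have "\<dots> = \<bar>(s / t - 1) * t\<bar> * d (\<xi> 0) (\<xi> 1)"
        using speed[of t] that by (simp add: abs_mult)
      also have "(s / t - 1) * t = s - t"
        using False by (simp add: left_diff_distrib)
      finally show ?thesis by simp
    qed (use that in_M[of 0] in auto)
    have "d (\<xi> s) (\<xi> t) = d (\<xi> 0) (\<xi> 1) * \<bar>s - t\<bar>" if "0 \<le> s" "0 \<le> t" for s t
    proof (cases "s \<le> t")
      case True
      then show ?thesis using le that by blast
    next
      case False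
      then show ?thesis
        using le[of t s] that commute[of "\<xi> s" "\<xi> t"] abs_minus_commute[of s t] by simp
    qed
    moreover have "\<xi> \<in> {0..} \<rightarrow> M"
      using in_M by auto
    ultimately show ?thesis
      unfolding linear_ray_def using seg by blast
  qed
  have in_XY: "fst (\<zeta> t) \<in> X" "snd (\<zeta> t) \<in> Y" if "t \<ge> 0" for t
    using Z.ray_in[OF \<zeta> that] by (auto simp: mem_Times_iff)
  have "prod_bicombing \<sigma>X \<sigma>Y (\<zeta> 0) (\<zeta> t) s = (\<sigma>X (fst (\<zeta> 0)) (fst (\<zeta> t)) s, \<sigma>Y (snd (\<zeta> 0)) (snd (\<zeta> t)) s)" for s t
    by (simp add: prod_bicombing_def case_prod_beta)
  then have seg: "\<sigma>X (fst (\<zeta> 0)) (fst (\<zeta> t)) s = fst (\<zeta> (s * t))" "\<sigma>Y (snd (\<zeta> 0)) (snd (\<zeta> t)) s = snd (\<zeta> (s * t))"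
    if "t \<ge> 0" "s \<in> {0..1}" for s t
    using Z.ray_segment[OF \<zeta> that] by (metis fst_conv, metis snd_conv)
  show thesis
  proof
    show "linear_ray X dX \<sigma>X (dX (fst (\<zeta> 0)) (fst (\<zeta> 1))) (\<lambda>t. fst (\<zeta> t))"
      using cX in_XY seg by (intro *) auto
    show "linear_ray Y dY \<sigma>Y (dY (snd (\<zeta> 0)) (snd (\<zeta> 1))) (\<lambda>t. snd (\<zeta> t))"
      using cY in_XY seg by (intro *) auto
    \<comment> \<open>The unit distance between \<open>\<zeta> 0\<close> and
      \<open>\<zeta> 1\<close> normalises the pair of speeds.\<close>
    show "lp_norm2 p (dX (fst (\<zeta> 0)) (fst (\<zeta> 1))) (dY (snd (\<zeta> 0)) (snd (\<zeta> 1))) = 1"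
      using Z.ray_dist[OF \<zeta>, of 0 1] by (simp add: lp_prod_dist_def case_prod_beta)
    show "\<zeta> = restrict (\<lambda>t. (fst (\<zeta> t), snd (\<zeta> t))) {0..}"
      using Z.ray_extensional[OF \<zeta>] by (simp add: extensional_restrict)
  qed
qed

text \<open>The argument common to the three shapes of the join. A point \<open>w\<close> stands for
  the pair of linear rays \<open>\<xi> w\<close> and \<open>\<eta> w\<close>, every admissible pair
  occurs, and \<open>q\<close> identifies two points exactly when their pairs agree.
  \<open>W\<close> will be the boundary of one factor, or the product of both boundaries with the
  interval.\<close>

lemma prod_boundary_homeomorphicI:
  fixes W :: "'w topology" and \<xi> :: "'w \<Rightarrow> real \<Rightarrow> 'a" and \<eta> :: "'w \<Rightarrow> real \<Rightarrow> 'b"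
  assumes p: "1 \<le> p" and cX: "conical_bicombing X dX \<sigma>X" and cY: "conical_bicombing Y dY \<sigma>Y"
    and base: "x0 \<in> X" "y0 \<in> Y" and W: "compact_space W"
    and lin: "\<And>w. w \<in> topspace W \<Longrightarrow>
      \<exists>a b. lp_norm2 p a b = 1 \<and> linear_ray X dX \<sigma>X a (\<xi> w) \<and> linear_ray Y dY \<sigma>Y b (\<eta> w)"
    and start: "\<And>w. w \<in> topspace W \<Longrightarrow> \<xi> w 0 = x0" "\<And>w. w \<in> topspace W \<Longrightarrow> \<eta> w 0 = y0"
    and contX: "\<And>t. t \<ge> 0 \<Longrightarrow> continuous_map W (Metric_space.mtopology X dX) (\<lambda>w. \<xi> w t)"
    and contY: "\<And>t. t \<ge> 0 \<Longrightarrow> continuous_map W (Metric_space.mtopology Y dY) (\<lambda>w. \<eta> w t)"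
    and surj: "\<And>\<xi>' \<eta>' a b. \<lbrakk>lp_norm2 p a b = 1; linear_ray X dX \<sigma>X a \<xi>'; linear_ray Y dY \<sigma>Y b \<eta>';
        \<xi>' 0 = x0; \<eta>' 0 = y0\<rbrakk> \<Longrightarrow> \<exists>w\<in>topspace W. \<forall>t\<ge>0. \<xi>' t = \<xi> w t \<and> \<eta>' t = \<eta> w t"
    and q: "quotient_map W J q"
    and fibres: "\<And>w w'. \<lbrakk>w \<in> topspace W; w' \<in> topspace W\<rbrakk> \<Longrightarrow>
        q w = q w' \<longleftrightarrow> (\<forall>t\<ge>0. \<xi> w t = \<xi> w' t \<and> \<eta> w t = \<eta> w' t)"
  shows "boundary_topology (X \<times> Y) (lp_prod_dist p dX dY) (prod_bicombing \<sigma>X \<sigma>Y) (x0, y0) homeomorphic_space J"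
proof -
  interpret X: conical_bicombing X dX \<sigma>X by fact
  interpret Y: conical_bicombing Y dY \<sigma>Y by fact
  interpret lp_product X dX Y dY p by unfold_locales (rule p)
  interpret Z: conical_bicombing "X \<times> Y" "lp_prod_dist p dX dY" "prod_bicombing \<sigma>X \<sigma>Y"
    using assms by (intro conical_bicombing_lp_prod)
  let ?Z = "boundary_topology (X \<times> Y) (lp_prod_dist p dX dY) (prod_bicombing \<sigma>X \<sigma>Y) (x0, y0)"
  let ?class = "\<lambda>\<zeta>. asymptotic (X \<times> Y) (lp_prod_dist p dX dY) (prod_bicombing \<sigma>X \<sigma>Y) `` {\<zeta>}"
  have z0: "(x0, y0) \<in> X \<times> Y" using base by simp
  define \<zeta> where "\<zeta> w = restrict (\<lambda>t. (\<xi> w t, \<eta> w t)) {0..}" for w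
  have ray: "\<zeta> w \<in> sigma_rays (X \<times> Y) (lp_prod_dist p dX dY) (prod_bicombing \<sigma>X \<sigma>Y)" if "w \<in> topspace W" for w
    unfolding \<zeta>_def using lin[OF that] prod_sigma_rayI[OF p cX cY] by blast
  have from_class: "ray_from (x0, y0) (?class (\<zeta> w)) = \<zeta> w" if "w \<in> topspace W" for w
    using Z.ray_from_class[OF ray[OF that]] start that by (simp add: \<zeta>_def)
  have \<zeta>_eq: "\<zeta> w = \<zeta> w' \<longleftrightarrow> (\<forall>t\<ge>0. \<xi> w t = \<xi> w' t \<and> \<eta> w t = \<eta> w' t)" for w w'
    by (auto simp: \<zeta>_def fun_eq_iff restrict_def)
  have "quotient_map W ?Z (\<lambda>w. ?class (\<zeta> w))"
  proof (rule continuous_closed_imp_quotient_map)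
    show cont: "continuous_map W ?Z (\<lambda>w. ?class (\<zeta> w))"
      unfolding Z.continuous_map_boundary_iff[OF z0]
    proof (intro conjI allI impI)
      show "(\<lambda>w. ?class (\<zeta> w)) \<in> topspace W \<rightarrow> boundary (X \<times> Y) (lp_prod_dist p dX dY) (prod_bicombing \<sigma>X \<sigma>Y)"
        using ray Z.class_in_boundary by blast
      fix t :: real assume t: "t \<ge> 0"
      have "continuous_map W lp.mtopology (\<lambda>w. (\<xi> w t, \<eta> w t))"
        using contX[OF t] contY[OF t] by (simp add: mtopology_lp_prod continuous_map_paired)
      then show "continuous_map W lp.mtopology (\<lambda>w. ray_from (x0, y0) (?class (\<zeta> w)) t)"
        by (rule continuous_map_eq) (use t from_class in \<open>simp add: \<zeta>_def\<close>)
    qed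
    \<comment> \<open>A continuous map from a compact space to a Hausdorff space is closed; being
      onto as well, it is a quotient map.\<close>
    show "closed_map W ?Z (\<lambda>w. ?class (\<zeta> w))"
      using W Hausdorff_imp_kc_space[OF Z.Hausdorff_space_boundary[OF z0]] cont
      by (rule continuous_imp_closed_map_gen)
    show "(\<lambda>w. ?class (\<zeta> w)) ` topspace W = topspace ?Z"
      unfolding Z.topspace_boundary_topology[OF z0]
    proof
      show "(\<lambda>w. ?class (\<zeta> w)) ` topspace W \<subseteq> boundary (X \<times> Y) (lp_prod_dist p dX dY) (prod_bicombing \<sigma>X \<sigma>Y)"
        using ray Z.class_in_boundary by blast
      show "boundary (X \<times> Y) (lp_prod_dist p dX dY) (prod_bicombing \<sigma>X \<sigma>Y) \<subseteq> (\<lambda>w. ?class (\<zeta> w)) ` topspace W"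
      proof
        fix c assume c: "c \<in> boundary (X \<times> Y) (lp_prod_dist p dX dY) (prod_bicombing \<sigma>X \<sigma>Y)"
        obtain \<xi>' \<eta>' a b where lin': "linear_ray X dX \<sigma>X a \<xi>'" "linear_ray Y dY \<sigma>Y b \<eta>'" "lp_norm2 p a b = 1"
          and r: "ray_from (x0, y0) c = restrict (\<lambda>t. (\<xi>' t, \<eta>' t)) {0..}"
          using prod_sigma_rayE[OF p cX cY Z.ray_from_ray[OF c z0]] .
        have "\<xi>' 0 = x0" "\<eta>' 0 = y0"
          using Z.ray_from_0[OF c z0] by (auto simp: r)
        then obtain w where w: "w \<in> topspace W" "\<forall>t\<ge>0. \<xi>' t = \<xi> w t \<and> \<eta>' t = \<eta> w t"
          using surj lin' by blast
        then have "ray_from (x0, y0) c = \<zeta> w"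
          by (auto simp: r \<zeta>_def restrict_def)
        then have "c = ?class (\<zeta> w)"
          using Z.class_ray_from[OF c z0] by simp
        with w show "c \<in> (\<lambda>w. ?class (\<zeta> w)) ` topspace W" by blast
      qed
    qed
  qed
  then show ?thesis
    using q
  proof (rule homeomorphic_space_quotients)
    fix w w' assume w: "w \<in> topspace W" "w' \<in> topspace W"
    \<comment> \<open>A class remembers its ray from the base point.\<close>
    have "?class (\<zeta> w) = ?class (\<zeta> w') \<longleftrightarrow> \<zeta> w = \<zeta> w'"
      using from_class[OF w(1)] from_class[OF w(2)] by metis
    then show "?class (\<zeta> w) = ?class (\<zeta> w') \<longleftrightarrow> q w = q w'"
      by (simp only: \<zeta>_eq fibres[OF w])
  qed
qed

text \<open>The radial projection of the segment from \<open>(1, 0)\<close> to \<open>(0, 1)\<close> to the unit sphere of the norm.\<close>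

definition lp_arc :: "ereal \<Rightarrow> real \<Rightarrow> real \<times> real" where
  "lp_arc p s = ((1 - s) / lp_norm2 p (1 - s) s, s / lp_norm2 p (1 - s) s)"

context
  fixes p :: ereal
  assumes p: "1 \<le> p"
begin

lemma lp_arc_norm_pos: "lp_norm2 p (1 - s) s > 0"
  using lp_norm2_nonneg[OF p, of "1 - s" s] lp_norm2_eq_0_iff[OF p, of "1 - s" s] by (auto simp: less_le)

lemma continuous_on_lp_arc:
  "continuous_on S (\<lambda>s. fst (lp_arc p s))" "continuous_on S (\<lambda>s. snd (lp_arc p s))"
proof -
  have "lp_norm2 p (1 - s) s \<noteq> 0" for s
    using lp_arc_norm_pos[of s] by simp
  then show "continuous_on S (\<lambda>s. fst (lp_arc p s))" "continuous_on S (\<lambda>s. snd (lp_arc p s))"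
    unfolding lp_arc_def by (auto intro!: continuous_intros continuous_on_lp_norm2 p)
qed

lemma lp_arc_nonneg: "s \<in> {0..1} \<Longrightarrow> fst (lp_arc p s) \<ge> 0" "s \<in> {0..1} \<Longrightarrow> snd (lp_arc p s) \<ge> 0"
  using lp_arc_norm_pos[of s] by (auto simp: lp_arc_def)

lemma lp_norm2_lp_arc: "lp_norm2 p (fst (lp_arc p s)) (snd (lp_arc p s)) = 1"
  using lp_norm2_scale[OF p, of "1 / lp_norm2 p (1 - s) s" "1 - s" s] lp_arc_norm_pos[of s]
  by (simp add: lp_arc_def)

lemma lp_arc_eq_0_iff: "fst (lp_arc p s) = 0 \<longleftrightarrow> s = 1" "snd (lp_arc p s) = 0 \<longleftrightarrow> s = 0"
  using lp_arc_norm_pos[of s] by (auto simp: lp_arc_def)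

text \<open>The coordinates of an arc point sum to the reciprocal of the norm, so equal points come
  from equal norms, and multiplying back gives the parameter.\<close>

lemma inj_lp_arc: "inj (lp_arc p)"
proof (rule injI)
  fix s t assume eq: "lp_arc p s = lp_arc p t"
  have sum: "fst (lp_arc p u) + snd (lp_arc p u) = 1 / lp_norm2 p (1 - u) u" for u
    by (simp add: lp_arc_def add_divide_distrib[symmetric])
  have "lp_norm2 p (1 - s) s = lp_norm2 p (1 - t) t"
    using sum[of s] sum[of t] eq by simp
  with eq show "s = t"
    using lp_arc_norm_pos[of t] by (simp add: lp_arc_def)
qed

lemma lp_arc_onto:
  assumes ab: "a \<ge> 0" "b \<ge> 0" "lp_norm2 p a b = 1"
  shows "\<exists>s\<in>{0..1}. lp_arc p s = (a, b)"
proof -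
  have "a + b \<noteq> 0"
    using ab lp_norm2_eq_0_iff[OF p, of a b] by auto
  with ab have pos: "a + b > 0" by linarith
  \<comment> \<open>Radial projection back to the segment: \<open>(a, b)\<close> divided by
    \<open>a + b\<close> is \<open>(1 - s, s)\<close>.\<close>
  define s where "s = b / (a + b)"
  have s: "1 - s = a / (a + b)"
    using pos by (simp add: s_def field_simps)
  have "lp_norm2 p (1 - s) s = 1 / (a + b)"
    using lp_norm2_scale[OF p, of "1 / (a + b)" a b] ab pos unfolding s by (simp add: s_def)
  then have "lp_arc p s = (a, b)"
    unfolding lp_arc_def s using pos by (simp add: s_def)
  moreover have "s \<in> {0..1}"
    using ab pos by (simp add: s_def)
  ultimately show ?thesis by blast
qed

end

section \<open>The boundary of the product as a join\<close>

theorem proposition5p11: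
  fixes X :: "'a set" and dX :: "'a \<Rightarrow> 'a \<Rightarrow> real" and \<sigma>X :: "'a \<Rightarrow> 'a \<Rightarrow> real \<Rightarrow> 'a"
    and Y :: "'b set" and dY :: "'b \<Rightarrow> 'b \<Rightarrow> real" and \<sigma>Y :: "'b \<Rightarrow> 'b \<Rightarrow> real \<Rightarrow> 'b"
    and p :: ereal and x0 :: 'a and y0 :: 'b and z0 :: "'a \<times> 'b"
  assumes "1 \<le> p"
    and "Metric_space X dX" and "proper_space X dX"
    and "Metric_space Y dY" and "proper_space Y dY"
    and "bicombing X dX \<sigma>X" and "consistent X \<sigma>X" and "conical X dX \<sigma>X"
    and "bicombing Y dY \<sigma>Y" and "consistent Y \<sigma>Y" and "conical Y dY \<sigma>Y"
    and "x0 \<in> X" and "y0 \<in> Y" and "z0 \<in> X \<times> Y"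
  shows "boundary_topology (X \<times> Y) (lp_prod_dist p dX dY) (prod_bicombing \<sigma>X \<sigma>Y) z0
           homeomorphic_space
         join (boundary_topology X dX \<sigma>X x0) (boundary_topology Y dY \<sigma>Y y0)"
proof -
  note p = \<open>1 \<le> p\<close> and base = \<open>x0 \<in> X\<close> \<open>y0 \<in> Y\<close>
  have cX: "conical_bicombing X dX \<sigma>X" and cY: "conical_bicombing Y dY \<sigma>Y"
    using assms by (auto intro: conical_bicombing_if_proper)
  interpret X: conical_bicombing X dX \<sigma>X by fact
  interpret Y: conical_bicombing Y dY \<sigma>Y by fact
  interpret Z: conical_bicombing "X \<times> Y" "lp_prod_dist p dX dY" "prod_bicombing \<sigma>X \<sigma>Y"
    using p cX cY by (rule conical_bicombing_lp_prod)
  let ?X = "boundary_topology X dX \<sigma>X x0" and ?Y = "boundary_topology Y dY \<sigma>Y y0"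
  let ?bX = "boundary X dX \<sigma>X" and ?bY = "boundary Y dY \<sigma>Y"
  note topX = X.topspace_boundary_topology[OF base(1)] and topY = Y.topspace_boundary_topology[OF base(2)]
  note compX = X.compact_space_boundary[OF base(1) assms(3)] and compY = Y.compact_space_boundary[OF base(2) assms(5)]
  \<comment> \<open>Rays of the product from \<open>(x0, y0)\<close> have components starting at the
    base points used for the factors; independence of the base point transfers the result to
    \<open>z0\<close> at the end.\<close>
  have "boundary_topology (X \<times> Y) (lp_prod_dist p dX dY) (prod_bicombing \<sigma>X \<sigma>Y) (x0, y0)
      homeomorphic_space join ?X ?Y"
  proof -
    consider "?bY = {}" | "?bY \<noteq> {}" "?bX = {}" | "?bX \<noteq> {}" "?bY \<noteq> {}" by blast
    then show ?thesis
    proof cases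
      case 1
      \<comment> \<open>The first component carries the whole speed and the second stays at
        \<open>y0\<close>. This case includes two empty boundaries.\<close>
      have J: "join ?X ?Y = image_topology End1 ?X"
        using 1 by (simp add: join_def topY)
      show ?thesis
        unfolding J
      proof (rule prod_boundary_homeomorphicI[OF p cX cY base compX,
            where \<xi> = "ray_from x0" and \<eta> = "\<lambda>_ _. y0", OF _ _ _ _ _ _ quotient_map_image_topology], unfold topX)
        fix c assume c: "c \<in> ?bX"
        show "\<exists>a b. lp_norm2 p a b = 1 \<and> linear_ray X dX \<sigma>X a (ray_from x0 c) \<and> linear_ray Y dY \<sigma>Y b (\<lambda>_. y0)"
          using X.linear_ray_scale[OF X.ray_from_ray[OF c base(1)], of 1] Y.linear_ray_const[OF base(2)]
            lp_norm2_axis[OF p, of 1] by auto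
        show "ray_from x0 c 0 = x0"
          using X.ray_from_0[OF c base(1)] .
        fix c' assume c': "c' \<in> ?bX"
        show "(End1 c :: ((real \<Rightarrow> 'a) set, (real \<Rightarrow> 'b) set) join_point) = End1 c' \<longleftrightarrow> (\<forall>t\<ge>0. ray_from x0 c t = ray_from x0 c' t \<and> y0 = y0)"
          using X.ray_from_scale_eqD(2)[OF c c' base(1), of 1 1] by auto
      next
        fix t :: real assume "t \<ge> 0"
        then show "continuous_map ?X X.mtopology (\<lambda>c. ray_from x0 c t)"
          by (rule X.continuous_map_ray_from_at[OF base(1)])
        show "continuous_map ?X Y.mtopology (\<lambda>c. y0)"
          using base by simp
      next
        fix \<xi> \<eta> a b
        assume ab: "lp_norm2 p a b = 1" and \<xi>: "linear_ray X dX \<sigma>X a \<xi>" "\<xi> 0 = x0"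
          and \<eta>: "linear_ray Y dY \<sigma>Y b \<eta>" "\<eta> 0 = y0"
        \<comment> \<open>Positive speed in \<open>Y\<close> would produce a point of its empty
          boundary.\<close>
        have "\<not> b > 0"
          using Y.linear_ray_eq_ray_from[OF \<eta>(1)] 1 by blast
        then have "b = 0"
          using Y.linear_ray_nonneg[OF \<eta>(1)] by simp
        with ab have "a = 1"
          using X.linear_ray_nonneg[OF \<xi>(1)] by (simp add: lp_norm2_axis[OF p])
        then show "\<exists>c\<in>?bX. \<forall>t\<ge>0. \<xi> t = ray_from x0 c t \<and> \<eta> t = y0"
          using X.linear_ray_eq_ray_from[OF \<xi>(1)] \<xi>(2) Y.linear_ray_0 \<eta> \<open>b = 0\<close>
          by (metis mult_1 zero_less_one)
      qed auto
    next
      case 2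
      have J: "join ?X ?Y = image_topology End2 ?Y"
        using 2 by (simp add: join_def topX topY)
      show ?thesis
        unfolding J
      proof (rule prod_boundary_homeomorphicI[OF p cX cY base compY,
            where \<xi> = "\<lambda>_ _. x0" and \<eta> = "ray_from y0", OF _ _ _ _ _ _ quotient_map_image_topology], unfold topY)
        fix c assume c: "c \<in> ?bY"
        show "\<exists>a b. lp_norm2 p a b = 1 \<and> linear_ray X dX \<sigma>X a (\<lambda>_. x0) \<and> linear_ray Y dY \<sigma>Y b (ray_from y0 c)"
          using Y.linear_ray_scale[OF Y.ray_from_ray[OF c base(2)], of 1] X.linear_ray_const[OF base(1)]
            lp_norm2_axis[OF p, of 1] by auto
        show "ray_from y0 c 0 = y0"
          using Y.ray_from_0[OF c base(2)] .
        fix c' assume c': "c' \<in> ?bY"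
        show "(End2 c :: ((real \<Rightarrow> 'a) set, (real \<Rightarrow> 'b) set) join_point) = End2 c' \<longleftrightarrow> (\<forall>t\<ge>0. x0 = x0 \<and> ray_from y0 c t = ray_from y0 c' t)"
          using Y.ray_from_scale_eqD(2)[OF c c' base(2), of 1 1] by auto
      next
        fix t :: real assume "t \<ge> 0"
        then show "continuous_map ?Y Y.mtopology (\<lambda>c. ray_from y0 c t)"
          by (rule Y.continuous_map_ray_from_at[OF base(2)])
        show "continuous_map ?Y X.mtopology (\<lambda>c. x0)"
          using base by simp
      next
        fix \<xi> \<eta> a b
        assume ab: "lp_norm2 p a b = 1" and \<xi>: "linear_ray X dX \<sigma>X a \<xi>" "\<xi> 0 = x0"
          and \<eta>: "linear_ray Y dY \<sigma>Y b \<eta>" "\<eta> 0 = y0"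
        have "\<not> a > 0"
          using X.linear_ray_eq_ray_from[OF \<xi>(1)] 2 by blast
        then have "a = 0"
          using X.linear_ray_nonneg[OF \<xi>(1)] by simp
        with ab have "b = 1"
          using Y.linear_ray_nonneg[OF \<eta>(1)] by (simp add: lp_norm2_axis[OF p])
        then show "\<exists>c\<in>?bY. \<forall>t\<ge>0. \<xi> t = x0 \<and> \<eta> t = ray_from y0 c t"
          using Y.linear_ray_eq_ray_from[OF \<eta>(1)] \<eta>(2) X.linear_ray_0 \<xi> \<open>a = 0\<close>
          by (metis mult_1 zero_less_one)
      qed auto
    next
      case 3
      let ?W = "prod_topology ?X (prod_topology ?Y (top_of_set {0..1::real}))"
      let ?q = "\<lambda>w. Class (join_rel ?bX ?bY `` {w})"
      have J: "join ?X ?Y = image_topology ?q ?W"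
        using 3 by (simp add: join_def topX topY)
      have topW: "topspace ?W = ?bX \<times> ?bY \<times> {0..1}"
        by (simp add: topX topY)
      have compW: "compact_space ?W"
        using compX compY by (simp add: compact_space_prod_topology compact_space_subtopology)
      \<comment> \<open>The speeds in \<open>X\<close> and \<open>Y\<close>: \<open>g\<close>
        vanishes at \<open>s = 0\<close> and \<open>f\<close> at \<open>s = 1\<close>, the ends at
        which the join forgets the second and the first boundary point respectively.\<close>
      define f g where "f s = fst (lp_arc p s)" and "g s = snd (lp_arc p s)" for s
      note cont = continuous_on_lp_arc[OF p, folded f_def g_def]
        and nonneg = lp_arc_nonneg[OF p, folded f_def g_def]
        and unit = lp_norm2_lp_arc[OF p, folded f_def g_def]
        and zero = lp_arc_eq_0_iff[OF p, folded f_def g_def]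
      define \<xi> where "\<xi> = (\<lambda>(c1, c2 :: (real \<Rightarrow> 'b) set, s) t. ray_from x0 c1 (f s * t))"
      define \<eta> where "\<eta> = (\<lambda>(c1 :: (real \<Rightarrow> 'a) set, c2, s) t. ray_from y0 c2 (g s * t))"
      have proj: "continuous_map ?W ?X (\<lambda>w. fst w)" "continuous_map ?W ?Y (\<lambda>w. fst (snd w))"
        "continuous_map ?W (top_of_set {0..1}) (\<lambda>w. snd (snd w))"
        using continuous_map_fst
          continuous_map_compose[OF continuous_map_snd continuous_map_fst]
          continuous_map_compose[OF continuous_map_snd continuous_map_snd]
        unfolding o_def by blast+
      have par: "continuous_map ?W euclideanreal (\<lambda>w. h (snd (snd w)) * t)"
        if "continuous_on {0..1} h" for h :: "real \<Rightarrow> real" and t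
      proof -
        have "continuous_map (top_of_set {0..1}) euclideanreal (\<lambda>s. h s * t)"
          using that by (auto intro!: continuous_intros)
        from continuous_map_compose[OF proj(3) this] show ?thesis by (simp add: o_def)
      qed
      show ?thesis
        unfolding J
      proof (rule prod_boundary_homeomorphicI[OF p cX cY base compW,
            where \<xi> = \<xi> and \<eta> = \<eta>, OF _ _ _ _ _ _ quotient_map_image_topology], unfold topW)
        fix w assume "w \<in> ?bX \<times> ?bY \<times> {0..1::real}"
        then obtain c1 c2 s where w: "w = (c1, c2, s)" and c: "c1 \<in> ?bX" "c2 \<in> ?bY" "s \<in> {0..1}"
          by blast
        show "\<exists>a b. lp_norm2 p a b = 1 \<and> linear_ray X dX \<sigma>X a (\<xi> w) \<and> linear_ray Y dY \<sigma>Y b (\<eta> w)"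
          using unit[of s] X.linear_ray_scale[OF X.ray_from_ray[OF c(1) base(1)] nonneg(1)[OF c(3)]]
            Y.linear_ray_scale[OF Y.ray_from_ray[OF c(2) base(2)] nonneg(2)[OF c(3)]]
          by (auto simp: w \<xi>_def \<eta>_def)
        show "\<xi> w 0 = x0" "\<eta> w 0 = y0"
          using X.ray_from_0[OF c(1) base(1)] Y.ray_from_0[OF c(2) base(2)] by (auto simp: w \<xi>_def \<eta>_def)
        fix w' assume w'W: "w' \<in> ?bX \<times> ?bY \<times> {0..1::real}"
        then obtain c1' c2' s' where w': "w' = (c1', c2', s')" and c': "c1' \<in> ?bX" "c2' \<in> ?bY" "s' \<in> {0..1}"
          by blast
        have "?q w = ?q w' \<longleftrightarrow> (w, w') \<in> join_rel ?bX ?bY"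
          using eq_equiv_class_iff[OF equiv_join_rel, of w ?bX ?bY w'] c w w'W by simp
        also have "\<dots> \<longleftrightarrow> s = s' \<and> (s \<noteq> 1 \<longrightarrow> c1 = c1') \<and> (s \<noteq> 0 \<longrightarrow> c2 = c2')"
          using c c' by (auto simp: w w' join_rel_def)
        also have "\<dots> \<longleftrightarrow> (\<forall>t\<ge>0. \<xi> w t = \<xi> w' t \<and> \<eta> w t = \<eta> w' t)"
        proof
          assume eq: "s = s' \<and> (s \<noteq> 1 \<longrightarrow> c1 = c1') \<and> (s \<noteq> 0 \<longrightarrow> c2 = c2')"
          have "f 1 = 0" "g 0 = 0" using zero by auto
          with eq show "\<forall>t\<ge>0. \<xi> w t = \<xi> w' t \<and> \<eta> w t = \<eta> w' t"
            using c c' base X.ray_from_0 Y.ray_from_0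
            by (cases "s = 0"; cases "s = 1") (auto simp: w w' \<xi>_def \<eta>_def)
        next
          assume eq: "\<forall>t\<ge>0. \<xi> w t = \<xi> w' t \<and> \<eta> w t = \<eta> w' t"
          have "f s = f s'" "f s > 0 \<Longrightarrow> c1 = c1'"
            using X.ray_from_scale_eqD[OF c(1) c'(1) base(1) nonneg(1)[OF c(3)] nonneg(1)[OF c'(3)]] eq
            by (auto simp: w w' \<xi>_def)
          moreover have "g s = g s'" "g s > 0 \<Longrightarrow> c2 = c2'"
            using Y.ray_from_scale_eqD[OF c(2) c'(2) base(2) nonneg(2)[OF c(3)] nonneg(2)[OF c'(3)]] eq
            by (auto simp: w w' \<eta>_def)
          \<comment> \<open>Equal speeds give \<open>s = s'\<close> by injectivity of the arc;
            \<open>zero\<close> turns \<open>s \<noteq> 1\<close> and \<open>s \<noteq> 0\<close>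
            into positive speeds.\<close>
          ultimately show "s = s' \<and> (s \<noteq> 1 \<longrightarrow> c1 = c1') \<and> (s \<noteq> 0 \<longrightarrow> c2 = c2')"
            using injD[OF inj_lp_arc[OF p], of s s'] zero[of s] nonneg[OF c(3)] by (auto simp: less_le f_def g_def prod_eq_iff)
        qed
        finally show "?q w = ?q w' \<longleftrightarrow> (\<forall>t\<ge>0. \<xi> w t = \<xi> w' t \<and> \<eta> w t = \<eta> w' t)" .
      next
        fix t :: real assume t: "t \<ge> 0"
        \<comment> \<open>Both the class and the time depend on \<open>w\<close>, hence joint
          continuity of evaluation is used.\<close>
        have "continuous_map ?W X.mtopology (\<lambda>w. ray_from x0 (fst w) (f (snd (snd w)) * t))"
          using t nonneg by (intro X.continuous_map_ray_from[OF base(1) proj(1)] par cont) (auto simp: topW)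
        then show "continuous_map ?W X.mtopology (\<lambda>w. \<xi> w t)"
          by (simp add: \<xi>_def case_prod_beta)
        have "continuous_map ?W Y.mtopology (\<lambda>w. ray_from y0 (fst (snd w)) (g (snd (snd w)) * t))"
          using t nonneg by (intro Y.continuous_map_ray_from[OF base(2) proj(2)] par cont) (auto simp: topW)
        then show "continuous_map ?W Y.mtopology (\<lambda>w. \<eta> w t)"
          by (simp add: \<eta>_def case_prod_beta)
      next
        fix \<xi>' \<eta>' a b
        assume ab: "lp_norm2 p a b = 1" and \<xi>': "linear_ray X dX \<sigma>X a \<xi>'" "\<xi>' 0 = x0"
          and \<eta>': "linear_ray Y dY \<sigma>Y b \<eta>'" "\<eta>' 0 = y0"
        obtain s where s: "s \<in> {0..1}" "a = f s" "b = g s"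
          using lp_arc_onto[OF p X.linear_ray_nonneg[OF \<xi>'(1)] Y.linear_ray_nonneg[OF \<eta>'(1)] ab]
          by (auto simp: f_def g_def)
        have "\<exists>c1\<in>?bX. \<forall>t\<ge>0. \<xi>' t = ray_from x0 c1 (a * t)"
        proof (cases "a > 0")
          case True
          then show ?thesis
            using X.linear_ray_eq_ray_from[OF \<xi>'(1)] \<xi>'(2) by metis
        next
          case False
          then have "a = 0" using X.linear_ray_nonneg[OF \<xi>'(1)] by simp
          \<comment> \<open>At speed 0 any class serves, and the boundary is non-empty in this
            case.\<close>
          obtain c where c: "c \<in> ?bX"
            using 3 by blast
          have "\<xi>' t = ray_from x0 c (a * t)" if "t \<ge> 0" for t
            using X.linear_ray_0[of \<xi>', OF _ that] \<xi>' X.ray_from_0[OF c base(1)] \<open>a = 0\<close> by simp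
          with c show ?thesis by blast
        qed
        then obtain c1 where c1: "c1 \<in> ?bX" "\<And>t. t \<ge> 0 \<Longrightarrow> \<xi>' t = ray_from x0 c1 (a * t)"
          by blast
        have "\<exists>c2\<in>?bY. \<forall>t\<ge>0. \<eta>' t = ray_from y0 c2 (b * t)"
        proof (cases "b > 0")
          case True
          then show ?thesis
            using Y.linear_ray_eq_ray_from[OF \<eta>'(1)] \<eta>'(2) by metis
        next
          case False
          then have "b = 0" using Y.linear_ray_nonneg[OF \<eta>'(1)] by simp
          obtain c where c: "c \<in> ?bY"
            using 3 by blast
          have "\<eta>' t = ray_from y0 c (b * t)" if "t \<ge> 0" for t
            using Y.linear_ray_0[of \<eta>', OF _ that] \<eta>' Y.ray_from_0[OF c base(2)] \<open>b = 0\<close> by simp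
          with c show ?thesis by blast
        qed
        then obtain c2 where c2: "c2 \<in> ?bY" "\<And>t. t \<ge> 0 \<Longrightarrow> \<eta>' t = ray_from y0 c2 (b * t)"
          by blast
        show "\<exists>w\<in>?bX \<times> ?bY \<times> {0..1}. \<forall>t\<ge>0. \<xi>' t = \<xi> w t \<and> \<eta>' t = \<eta> w t"
          using c1 c2 s by (intro bexI[of _ "(c1, c2, s)"]) (auto simp: \<xi>_def \<eta>_def)
      qed
    qed
  qed
  then show ?thesis
    using Z.boundary_topology_base_independent[of "(x0, y0)" z0] base \<open>z0 \<in> X \<times> Y\<close> by simp
qed

end
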